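(* Consider the quantum principal $\mathcal U(1)$-bundle $\zeta=(\mathbb T^{n+1}_\Xi,\mathbb T^n_\Xi,\Delta_P)$ over the quantum $n$-torus ($n\ge2$) with the differential calculus described in the context. Under the assignment $$\mathfrak{qpc}(\zeta)\longrightarrow\mathfrak{qlc}_C(E),\qquad \omega\longmapsto\widehat\nabla^\omega,$$ where $E=\mathrm{Mor}(\mathrm{ad},\Delta_P)$ is the right quantum vector bundle associated with the $\mathcal U(1)$-corepresentation $\mathrm{ad}$ on $\mathfrak u(1)^\#_{\mathbb C}$, every quantum principal connection gives a solution of the non-commutative analytical Yang–Mills equation on $E$. In other words, the gauge quantum linear connection of every quantum principal connection is a Yang–Mills quantum linear connection.
   Context: **Quantum tori.** Fix $n\ge2$ and a real antisymmetric $(n+1)\times(n+1)$ matrix $\Xi$. For $m\in\{n,n+1\}$, $\mathbb T^m_\Xi$ is the $*$-algebra of formal sums $\sum a_{k_1\cdots k_m}u_1^{k_1}\cdots u_m^{k_m}$ with rapidly decaying coefficients, with $u_k^*=u_k^{-1}$, $u_ku_j=e^{2\pi i\Xi_{kj}}u_ju_k$ ($k,j\le m$); $\mathbb T^n_\Xi\subset\mathbb T^{n+1}_\Xi$. $\delta_j$ is the derivation with $\delta_j(u_k)=2\pi i\,u_j$ if $k=j$ and $0$ otherwise. $\Omega^\bullet(\mathbb T^m_\Xi)=\mathbb T^m_\Xi\otimes\bigwedge^\bullet\mathbb C^m$ with $(x_1\otimes v_1)(x_2\otimes v_2)=x_1x_2\otimes v_1\wedge v_2$, $(x\otimes v)^*=x^*\otimes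 v^*$ ($v^*$ complex conjugation in the canonical basis $\bar e_j$), $d\mathbb U_j:=\mathbf 1\otimes\bar e_j$, $dx=i\sum_j\delta_j(x)\,d\mathbb U_j$, $d(x\,d\mathbb U_{j_1}\cdots d\mathbb U_{j_k})=dx\,d\mathbb U_{j_1}\cdots d\mathbb U_{j_k}$; so $d(a^* )=-(da)^*$. Hodge operator $\star_q:\Omega^k(\mathbb T^n_\Xi)\to\Omega^{n-k}(\mathbb T^n_\Xi)$, $x\otimes v\mapsto x\otimes\star v$, with $\star$ the Hodge operator of $\bigwedge^\bullet\mathbb C^n$. **Bundle.** $G=\mathbb C[z,z^{-1}]$, $z^*=z^{-1}$, $\Delta(z^k)=z^k\otimes z^k$, $\epsilon(z^k)=1$, $S(z^k)=z^{k*}$. Classical calculus of $U(1)$: $\vartheta:=\pi(z)=z^*dz$, $\mathfrak u(1)^\#_{\mathbb C}=\mathbb C\vartheta$ (with $\vartheta$ of norm $1$), $\Gamma^\wedge=G\oplus G\vartheta$, $\vartheta$ commutes with $G$, $\vartheta^2=0$, $d\vartheta=0$, $\vartheta^*=\vartheta$, $\pi(z^k)=k\vartheta$, $\mathrm{ad}(\vartheta)=\vartheta\otimes\mathbf 1$. $P=\mathbb T^{n+1}_\Xi$, $\Delta_P(u_i)=u_i\otimes\mathbf 1$ ($i\le n$), $\Delta_P(u_{n+1})=u_{n+1}\otimes z$; $\Omega^\bullet(P)=\Omega^\bullet(\mathbb T^{n+1}_\Xi)$ with $\Delta_{\Omega^\bullet(P)}:\Omega^\bullet(P)\to\Omega^\bullet(P)\otimes\Gamma^\wedge$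 the graded differential $*$-algebra morphism extending $\Delta_P$. Horizontal forms $\mathrm{Hor}^\bullet P=P\,\Omega^\bullet(\mathbb T^n_\Xi)$; base algebra $B=\mathbb T^n_\Xi$, base forms $\Omega^\bullet(\mathbb T^n_\Xi)$. **Connections.** $\mathfrak{qpc}(\zeta)$ is the set of quantum principal connections: linear maps $\omega:\mathfrak u(1)^\#_{\mathbb C}\to\Omega^1(P)$ with $\Delta_{\Omega^\bullet(P)}(\omega(\theta))=(\omega\otimes\mathrm{id})\mathrm{ad}(\theta)+\mathbf 1\otimes\theta$ and $\omega(\theta^* )=\omega(\theta)^*$. Dual covariant derivative: $\widehat D^\omega(\varphi)=d\varphi+\omega(\pi(S^{-1}(\varphi^{(1)})))\varphi^{(0)}$ for horizontal $\varphi$ with $\Delta_{\Omega^\bullet(P)}(\varphi)=\varphi^{(0)}\otimes\varphi^{(1)}$; $\widehat D^\omega(T)(\theta)=\widehat D^\omega(T(\theta))$. **Associated bundle.** $E=\mathrm{Mor}(\mathrm{ad},\Delta_P)$ is the right $B$-module of linear $T:\mathbb C\vartheta\to P$ with $(T\otimes\mathrm{id})\mathrm{ad}=\Delta_PT$, with metric $\langle T_1,T_2\rangle_{\mathrm R}=T_1(\vartheta)^*T_2(\vartheta)$, extended by $\langle T_1\otimes\mu_1,T_2\otimes\mu_2\rangle_{\mathrm R}=\mu_1^*\langle T_1,T_2\rangle_{\mathrm R}\mu_2$. $\widehat\Upsilon:\mathrm{Mor}(\mathrm{ad},\Delta_{\mathrm{Hor}})\to E\otimes_B\Omega^\bullet(B)$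 is the isomorphism with inverse $T\otimes\mu\mapsto T\mu$. The gauge quantum linear connection of $\omega$ is $\widehat\nabla^\omega=\widehat\Upsilon\circ\widehat D^\omega:E\to E\otimes_B\Omega^1(B)$. $\mathfrak{qlc}_C(E)$ is the set of quantum linear connections $\widehat\nabla$ on $E$ (right Leibniz rule $\widehat\nabla(Tb)=\widehat\nabla(T)b+T\otimes db$) with $\langle T_1,\widehat\nabla T_2\rangle_{\mathrm R}-\langle\widehat\nabla T_1,T_2\rangle_{\mathrm R}=d\langle T_1,T_2\rangle_{\mathrm R}$; gauge quantum linear connections belong to it. **Analytical Yang–Mills equation.** $d^{\widehat\nabla}(T\otimes\nu)=\widehat\nabla(T)\nu+T\otimes d\nu$, $R^{\widehat\nabla}=d^{\widehat\nabla}\circ\widehat\nabla$. For right $B$-linear $\widehat\Lambda:E\to E\otimes_B\Omega^k(B)$: $\widehat\Lambda^{\mathrm{ext}}(T\otimes\nu)=\widehat\Lambda(T)\nu$, $[\widehat\nabla,\widehat\Lambda]=d^{\widehat\nabla}\circ\widehat\Lambda-(-1)^k\widehat\Lambda^{\mathrm{ext}}\circ\widehat\nabla$. The equation is $[\widehat\nabla,(\mathrm{id}_E\otimes_B\star_q)\circ R^{\widehat\nabla}]=0$; its solutions in $\mathfrak{qlc}_C(E)$ are the Yang–Mills quantum linear connections. *)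

theory Defs
  imports
    "HOL-Analysis.Analysis"
    "HOL-Library.Function_Algebras"
    "HOL-Library.Multiset"
begin

text \<open>
  Indices are 0-based: the generators of \<open>\<T>\<^sup>n\<close> are \<open>qgen 0, \<dots>, qgen (n - 1)\<close>, the fibre generator
  \<open>u\<^sub>n\<^sub>+\<^sub>1\<close> is \<open>qgen n\<close>, and \<open>\<Xi> i j\<close> matters for \<open>i, j \<le> n\<close> only.

  An element \<open>\<Sum> a\<^sub>k u\<^sub>0\<^bsup>k 0\<^esup> u\<^sub>1\<^bsup>k 1\<^esup> \<dots>\<close> of a quantum torus is its coefficient function \<open>a\<close> on
  multi-indices \<open>k :: nat \<Rightarrow> int\<close>.  A differential form \<open>\<Sum> x\<^sub>I \<otimes> e\<^sub>I\<close> is the function \<open>I \<mapsto> x\<^sub>I\<close>, where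
  \<open>e\<^sub>I\<close> is the wedge of the \<open>e\<^sub>i\<close>, \<open>i \<in> I\<close>, in increasing order.  Hence \<open>\<T>\<^sup>n\<close> and its forms are
  literally subsets of \<open>\<T>\<^sup>n\<^sup>+\<^sup>1\<close> and its forms, with the same operations.  The algebras are
  identified with their forms of degree 0.  Addition of functions is pointwise
  (Function-Algebras); the pointwise product of functions is never used.
\<close>

type_synonym qt = "(nat \<Rightarrow> int) \<Rightarrow> complex"
type_synonym qform = "nat set \<Rightarrow> qt"

definition lattice_pts :: "nat \<Rightarrow> (nat \<Rightarrow> int) set" where
  "lattice_pts m = {k. \<forall>i\<ge>m. k i = 0}"

definition qtorus :: "nat \<Rightarrow> qt set" where
  "qtorus m = {a. (\<forall>k. k \<notin> lattice_pts m \<longrightarrow> a k = 0) \<and>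
     (\<forall>N::nat. \<exists>C. \<forall>k. (1 + (\<Sum>i<m. real_of_int \<bar>k i\<bar>)) ^ N * norm (a k) \<le> C)}"

definition Forms :: "nat \<Rightarrow> qform set" where
  "Forms m = {\<mu>. \<forall>I. if I \<subseteq> {..<m} then \<mu> I \<in> qtorus m else \<mu> I = 0}"

definition Forms_deg :: "nat \<Rightarrow> nat \<Rightarrow> qform set" where
  "Forms_deg m k = {\<mu> \<in> Forms m. \<forall>I. card I \<noteq> k \<longrightarrow> \<mu> I = 0}"

definition qmonom :: "(nat \<Rightarrow> int) \<Rightarrow> qt" where
  "qmonom p = (\<lambda>k. if k = p then 1 else 0)"

definition qgen :: "nat \<Rightarrow> qt" where
  "qgen i = qmonom (\<lambda>j. if j = i then 1 else 0)"

definition deg0 :: "qt \<Rightarrow> qform" where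
  "deg0 x = (\<lambda>I. if I = {} then x else 0)"

definition dU :: "nat set \<Rightarrow> qform" where
  "dU I = (\<lambda>J. if J = I then qmonom 0 else 0)"

definition fone :: qform where
  "fone = deg0 (qmonom 0)"

definition fscale :: "complex \<Rightarrow> qform \<Rightarrow> qform" where
  "fscale c \<mu> = (\<lambda>I k. c * \<mu> I k)"

text \<open>\<open>e\<^sub>I \<and> e\<^sub>J = wsign I J e\<^sub>I\<^sub>\<union>\<^sub>J\<close> for disjoint \<open>I\<close>, \<open>J\<close>.\<close>

definition wsign :: "nat set \<Rightarrow> nat set \<Rightarrow> complex" where
  "wsign I J = (-1) ^ card {(i, j). i \<in> I \<and> j \<in> J \<and> j < i}"

definition qderiv :: "nat \<Rightarrow> qt \<Rightarrow> qt" where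
  "qderiv j x = (\<lambda>k. 2 * of_real pi * \<i> * of_int (k j) * x k)"


subsection \<open>The structure group and its calculus\<close>

text \<open>
  A Laurent polynomial is its coefficient function \<open>int \<Rightarrow> complex\<close>, and the line spanned by
  \<open>\<vartheta> = z\<^sup>* dz\<close> is \<open>complex\<close>, with \<open>\<vartheta> = 1\<close> and \<open>\<theta>\<^sup>* = cnj \<theta>\<close>.
\<close>

definition zpow :: "int \<Rightarrow> int \<Rightarrow> complex" where
  "zpow k = (\<lambda>j. if j = k then 1 else 0)"

definition antipode :: "(int \<Rightarrow> complex) \<Rightarrow> int \<Rightarrow> complex" where
  "antipode g = (\<lambda>j. g (- j))"

definition qgerm :: "(int \<Rightarrow> complex) \<Rightarrow> complex" where
  "qgerm g = (\<Sum>j\<in>{j. g j \<noteq> 0}. of_int j * g j)"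

text \<open>\<open>ad \<theta> = \<theta> \<otimes> \<one>\<close>; a function \<open>int \<Rightarrow> complex\<close> stands here for \<open>\<Sum>\<^sub>j F j \<otimes> z\<^sup>j\<close>.\<close>

definition ad_corep :: "complex \<Rightarrow> int \<Rightarrow> complex" where
  "ad_corep \<theta> = (\<lambda>j. if j = 0 then \<theta> else 0)"

text \<open>
  \<open>F :: int \<Rightarrow> nat \<Rightarrow> qform\<close> stands for \<open>\<Sum>\<^sub>j (F j 0 \<otimes> z\<^sup>j + F j 1 \<otimes> z\<^sup>j \<vartheta>)\<close>, an element of
  \<open>\<Omega>(P) \<otimes> \<Gamma>\<^sup>\<and>\<close>.  The sum over \<open>j\<close> may be infinite: the coaction of a rapidly decaying series
  involves infinitely many powers of \<open>z\<close>, so the tensor product has to be read as a completed one.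
\<close>

type_synonym qtens = "int \<Rightarrow> nat \<Rightarrow> qform"

definition tensor_id :: "(complex \<Rightarrow> qform) \<Rightarrow> (int \<Rightarrow> complex) \<Rightarrow> qtens" where
  "tensor_id T F = (\<lambda>j \<epsilon>. if \<epsilon> = 0 then T (F j) else 0)"

definition one_tensor :: "complex \<Rightarrow> qtens" where
  "one_tensor \<theta> = (\<lambda>j \<epsilon>. if j = 0 \<and> \<epsilon> = 1 then fscale \<theta> fone else 0)"

type_synonym emor = "complex \<Rightarrow> qform"
type_synonym fsum = "(emor \<times> qform) multiset"
type_synonym tens = "fsum set"

locale quantum_torus_bundle =
  fixes n :: nat and \<Xi> :: "nat \<Rightarrow> nat \<Rightarrow> real"
begin

subsection \<open>Quantum tori and their forms\<close>

text \<open>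
  \<open>u\<^sup>k u\<^sup>l = cocycle k l u\<^sup>k\<^sup>+\<^sup>l\<close>: the powers \<open>u\<^sub>j\<^bsup>l j\<^esup>\<close> are moved to the left past \<open>u\<^sub>i\<^bsup>k i\<^esup>\<close> for \<open>j < i\<close>,
  using \<open>u\<^sub>i u\<^sub>j = exp (2\<pi>\<i> \<Xi>\<^sub>i\<^sub>j) u\<^sub>j u\<^sub>i\<close>.  Consequently \<open>(u\<^sup>k)\<^sup>* = (u\<^sup>k)\<^sup>-\<^sup>1 = cnj (cocycle k (-k)) u\<^sup>-\<^sup>k\<close>.
\<close>

definition cocycle :: "(nat \<Rightarrow> int) \<Rightarrow> (nat \<Rightarrow> int) \<Rightarrow> complex" where
  "cocycle k l = cis (2 * pi * (\<Sum>i\<le>n. \<Sum>j<i. \<Xi> i j * of_int (k i) * of_int (l j)))"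

definition qmul :: "qt \<Rightarrow> qt \<Rightarrow> qt" where
  "qmul x y = (\<lambda>k. \<Sum>\<^sub>\<infinity>p\<in>lattice_pts (Suc n). cocycle p (k - p) * x p * y (k - p))"

definition qstar :: "qt \<Rightarrow> qt" where
  "qstar x = (\<lambda>k. cnj (x (- k)) * cnj (cocycle (- k) k))"

definition fmul :: "qform \<Rightarrow> qform \<Rightarrow> qform" (infixl \<open>\<odot>\<close> 70) where
  "\<mu> \<odot> \<nu> = (\<lambda>K k. \<Sum>I\<in>Pow K. wsign I (K - I) * qmul (\<mu> I) (\<nu> (K - I)) k)"

definition fstar :: "qform \<Rightarrow> qform" where
  "fstar \<mu> = (\<lambda>I. qstar (\<mu> I))"

definition dfun :: "qt \<Rightarrow> qform" where
  "dfun x = fscale \<i> (\<Sum>j\<le>n. deg0 (qderiv j x) \<odot> dU {j})"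

definition fd :: "qform \<Rightarrow> qform" where
  "fd \<mu> = (\<Sum>I\<in>Pow {..n}. dfun (\<mu> I) \<odot> dU I)"

text \<open>
  The complex linear Hodge operator on the forms of \<open>\<T>\<^sup>n\<close>, normalised by
  \<open>e\<^sub>I \<and> \<star> e\<^sub>I = e\<^sub>0 \<and> \<dots> \<and> e\<^sub>n\<^sub>-\<^sub>1\<close>.
\<close>

definition hodge :: "qform \<Rightarrow> qform" where
  "hodge \<mu> = (\<lambda>K. if K \<subseteq> {..<n} then (\<lambda>k. wsign ({..<n} - K) K * \<mu> ({..<n} - K) k) else 0)"

text \<open>The defining relations of the quantum torus.\<close>

lemma qmul_qmonom:
  assumes "p \<in> lattice_pts (Suc n)"
  shows "qmul (qmonom p) (qmonom q) = (\<lambda>k. cocycle p q * qmonom (p + q) k)"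
proof
  fix k
  let ?f = "\<lambda>r. cocycle r (k - r) * qmonom p r * qmonom q (k - r)"
  have "qmul (qmonom p) (qmonom q) k = infsum ?f {p}"
    unfolding qmul_def by (rule infsum_cong_neutral) (use assms in \<open>auto simp: qmonom_def\<close>)
  also have "\<dots> = ?f p" by simp
  also have "\<dots> = cocycle p q * qmonom (p + q) k"
    by (auto simp: qmonom_def algebra_simps)
  finally show "qmul (qmonom p) (qmonom q) k = cocycle p q * qmonom (p + q) k" .
qed

lemma cocycle_gen:
  assumes "i \<le> n"
  shows "cocycle (\<lambda>k. if k = i then 1 else 0) (\<lambda>k. if k = j then 1 else 0)
       = (if j < i then cis (2 * pi * \<Xi> i j) else 1)"
proof -
  have "(\<Sum>i'\<le>n. \<Sum>j'<i'. \<Xi> i' j' * of_int (if i' = i then 1 else 0) * of_int (if j' = j then 1 else 0))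
     = (\<Sum>i'\<le>n. if i' = i then (\<Sum>j'<i. if j' = j then \<Xi> i j else 0) else 0)"
  proof (intro sum.cong refl)
    fix a show "(\<Sum>j'<a. \<Xi> a j' * of_int (if a = i then 1 else 0) * of_int (if j' = j then 1 else 0))
        = (if a = i then (\<Sum>j'<i. if j' = j then \<Xi> i j else 0) else 0)"
    proof (cases "a = i")
      case True
      have "\<Xi> i j' * of_int (if i = i then 1 else 0) * of_int (if j' = j then 1 else 0)
          = (if j' = j then \<Xi> i j else 0)" for j'
        by simp
      then show ?thesis using True by simp
    qed simp
  qed
  also have "\<dots> = (if j < i then \<Xi> i j else 0)"
    using assms by (simp add: sum.delta)
  finally show ?thesis by (simp add: cocycle_def)
qed

lemma qgen_commute:
  assumes "i \<le> n" "j \<le> n" "\<Xi> i j = - \<Xi> j i"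
  shows "qmul (qgen i) (qgen j) = (\<lambda>k. cis (2 * pi * \<Xi> i j) * qmul (qgen j) (qgen i) k)"
proof -
  have l: "(\<lambda>k. if k = i then 1 else 0) \<in> lattice_pts (Suc n)" if "i \<le> n" for i
    using that by (auto simp: lattice_pts_def)
  show ?thesis
    unfolding qgen_def qmul_qmonom[OF l[OF assms(1)]] qmul_qmonom[OF l[OF assms(2)]]
      cocycle_gen[OF assms(1)] cocycle_gen[OF assms(2)]
    using assms(3)
    by (cases i j rule: linorder_cases)
       (auto simp: add.commute cis_mult fun_eq_iff)
qed

lemma qstar_qmonom: "qstar (qmonom p) = (\<lambda>k. cnj (cocycle p (- p)) * qmonom (- p) k)"
proof
  fix k :: "nat \<Rightarrow> int"
  have "- k = p \<longleftrightarrow> k = - p" by (rule minus_equation_iff[THEN trans]) (rule eq_commute)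
  then show "qstar (qmonom p) k = cnj (cocycle p (- p)) * qmonom (- p) k"
    by (cases "k = - p") (simp_all add: qstar_def qmonom_def)
qed

lemma qmul_scale_left: "qmul (\<lambda>k. c * x k) y = (\<lambda>k. c * qmul x y k)"
  unfolding qmul_def infsum_cmult_right'[symmetric] by (simp only: ac_simps)

lemma qmul_scale_right: "qmul x (\<lambda>k. c * y k) = (\<lambda>k. c * qmul x y k)"
  unfolding qmul_def infsum_cmult_right'[symmetric] by (simp only: ac_simps)

lemma qmonom_unitary:
  assumes "p \<in> lattice_pts (Suc n)"
  shows "qmul (qmonom p) (qstar (qmonom p)) = qmonom 0"
    and "qmul (qstar (qmonom p)) (qmonom p) = qmonom 0"
proof -
  have *: "cocycle (-p) p = cocycle p (-p)" by (simp add: cocycle_def sum_negf)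
  have **: "cnj (cocycle p q) * cocycle p q = 1" "cocycle p q * cnj (cocycle p q) = 1" for p q
   by (simp_all add: cocycle_def cis_cnj cis_mult)
  have l: "-p \<in> lattice_pts (Suc n)" using assms by (auto simp: lattice_pts_def)
  show "qmul (qstar (qmonom p)) (qmonom p) = qmonom 0"
    unfolding qstar_qmonom qmul_scale_left qmul_qmonom[OF l] * by (simp add: ** mult.assoc[symmetric])
show "qmul (qmonom p) (qstar (qmonom p)) = qmonom 0"
    unfolding qstar_qmonom qmul_scale_right qmul_qmonom[OF assms] by (simp add: ** mult.assoc[symmetric])
qed

abbreviation P :: "qform set" where "P \<equiv> Forms_deg (Suc n) 0"
abbreviation B :: "qform set" where "B \<equiv> Forms_deg n 0"


subsection \<open>The bundle\<close>

text \<open>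
  The coaction on forms.  In degree 0 it is \<open>\<Delta>\<^sub>P (u\<^sup>k) = u\<^sup>k \<otimes> z\<^bsup>k n\<^esup>\<close>.  As \<open>dU\<^sub>i = -1/(2\<pi>) u\<^sub>i\<^sup>* du\<^sub>i\<close>,
  compatibility with products and differentials forces \<open>dU\<^sub>i \<mapsto> dU\<^sub>i \<otimes> \<one>\<close> for \<open>i < n\<close> and
  \<open>dU\<^sub>n \<mapsto> dU\<^sub>n \<otimes> \<one> - 1/(2\<pi>) \<one> \<otimes> \<vartheta>\<close>.  So, for \<open>I\<close> not containing \<open>n\<close>,
  \<open>u\<^sup>k dU\<^sub>I \<mapsto> u\<^sup>k dU\<^sub>I \<otimes> z\<^bsup>k n\<^esup>\<close> and
  \<open>u\<^sup>k dU\<^sub>I dU\<^sub>n \<mapsto> u\<^sup>k dU\<^sub>I dU\<^sub>n \<otimes> z\<^bsup>k n\<^esup> - 1/(2\<pi>) u\<^sup>k dU\<^sub>I \<otimes> z\<^bsup>k n\<^esup> \<vartheta>\<close>.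
\<close>

definition coaction :: "qform \<Rightarrow> qtens" where
  "coaction \<mu> = (\<lambda>j \<epsilon> I k.
     if k n \<noteq> j then 0
     else if \<epsilon> = 0 then \<mu> I k
     else if \<epsilon> = 1 \<and> n \<notin> I then - \<mu> (insert n I) k / (2 * of_real pi)
     else 0)"

definition Hor :: "qform set" where
  "Hor = {\<Sum>i<N. x i \<odot> \<mu> i | (N::nat) x \<mu>. \<forall>i<N. x i \<in> P \<and> \<mu> i \<in> Forms n}"

definition qpc :: "emor set" where
  "qpc = {\<omega>. Vector_Spaces.linear (*) fscale \<omega> \<and> range \<omega> \<subseteq> Forms_deg (Suc n) 1 \<and>
     (\<forall>\<theta>. coaction (\<omega> \<theta>) = tensor_id \<omega> (ad_corep \<theta>) + one_tensor \<theta>) \<and>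
     (\<forall>\<theta>. \<omega> (cnj \<theta>) = fstar (\<omega> \<theta>))}"

text \<open>Up to horizontal terms, \<open>\<vartheta> \<mapsto> -2\<pi> dU\<^sub>n\<close> is the shape of every connection.\<close>

lemma qpc_canonical: "(\<lambda>\<theta>. fscale (- 2 * of_real pi * \<theta>) (dU {n})) \<in> qpc"
proof -
  have r': "(\<lambda>k. c * qmonom 0 k) \<in> qtorus (Suc n)" for c
    unfolding qtorus_def
    by (auto simp: qmonom_def lattice_pts_def intro!: exI[of _ "norm c"])
  have z: "0 \<in> qtorus (Suc n)" by (auto simp: qtorus_def intro!: exI[of _ 0])
  have 1: "Vector_Spaces.linear (*) fscale (\<lambda>\<theta>. fscale (- 2 * of_real pi * \<theta>) (dU {n}))"
    by (unfold_locales) (auto simp: fscale_def fun_eq_iff algebra_simps)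
  show ?thesis unfolding qpc_def
    apply (intro CollectI conjI allI 1)
    subgoal using r'[of "- 2 * of_real pi * _"] z
      by (auto simp: Forms_deg_def Forms_def fscale_def dU_def zero_fun_def)
    subgoal
      by (auto simp: fun_eq_iff coaction_def tensor_id_def ad_corep_def one_tensor_def fscale_def
          dU_def qmonom_def fone_def deg0_def zero_fun_def)
    subgoal
      by (auto simp: fun_eq_iff fstar_def fscale_def dU_def qstar_def qmonom_def cocycle_def zero_fun_def)
    done
qed

text \<open>
  For horizontal \<open>\<phi>\<close> the coaction is \<open>\<phi>\<^sup>(\<^sup>0\<^sup>) \<otimes> \<phi>\<^sup>(\<^sup>1\<^sup>) = \<Sum>\<^sub>j coaction \<phi> j 0 \<otimes> z\<^sup>j\<close>, without \<open>\<vartheta>\<close> part;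
  the sum over \<open>j\<close> converges coefficientwise.
\<close>

definition dual_cov_deriv :: "emor \<Rightarrow> qform \<Rightarrow> qform" where
  "dual_cov_deriv \<omega> \<phi> = fd \<phi> +
     (\<lambda>I k. \<Sum>\<^sub>\<infinity>j. (\<omega> (qgerm (inv antipode (zpow j))) \<odot> coaction \<phi> j 0) I k)"


subsection \<open>The associated bundle and its tensor products\<close>

definition Mor_ad :: "qform set \<Rightarrow> emor set" where
  "Mor_ad W = {T. Vector_Spaces.linear (*) fscale T \<and> range T \<subseteq> W \<and>
     (\<forall>\<theta>. tensor_id T (ad_corep \<theta>) = coaction (T \<theta>))}"

abbreviation E :: "emor set" where "E \<equiv> Mor_ad P"

definition rmul :: "emor \<Rightarrow> qform \<Rightarrow> emor" where
  "rmul T \<mu> = (\<lambda>\<theta>. T \<theta> \<odot> \<mu>)"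

text \<open>
  The tensor product of \<open>E\<close> and \<open>\<Omega>(B)\<close> over \<open>B\<close>: formal finite sums of pairs (multisets) modulo
  the congruence generated by biadditivity and \<open>T b \<otimes> \<mu> = T \<otimes> b \<mu>\<close>.
\<close>

inductive teq :: "fsum \<Rightarrow> fsum \<Rightarrow> bool" where
  teq_refl: "set_mset M \<subseteq> E \<times> Forms n \<Longrightarrow> teq M M"
| teq_sym: "teq M N \<Longrightarrow> teq N M"
| teq_trans: "teq M N \<Longrightarrow> teq N K \<Longrightarrow> teq M K"
| teq_add: "teq M N \<Longrightarrow> set_mset K \<subseteq> E \<times> Forms n \<Longrightarrow> teq (M + K) (N + K)"
| teq_zero_left: "\<mu> \<in> Forms n \<Longrightarrow> teq {#(0, \<mu>)#} {#}"
| teq_zero_right: "T \<in> E \<Longrightarrow> teq {#(T, 0)#} {#}"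
| teq_add_left: "T \<in> E \<Longrightarrow> T' \<in> E \<Longrightarrow> \<mu> \<in> Forms n \<Longrightarrow>
    teq {#(T + T', \<mu>)#} {#(T, \<mu>), (T', \<mu>)#}"
| teq_add_right: "T \<in> E \<Longrightarrow> \<mu> \<in> Forms n \<Longrightarrow> \<mu>' \<in> Forms n \<Longrightarrow>
    teq {#(T, \<mu> + \<mu>')#} {#(T, \<mu>), (T, \<mu>')#}"
| teq_balanced: "T \<in> E \<Longrightarrow> b \<in> B \<Longrightarrow> \<mu> \<in> Forms n \<Longrightarrow>
    teq {#(rmul T b, \<mu>)#} {#(T, b \<odot> \<mu>)#}"

definition tcls :: "fsum \<Rightarrow> tens" where
  "tcls M = {N. teq M N}"

definition Tens :: "tens set" where
  "Tens = {tcls M | M. set_mset M \<subseteq> E \<times> Forms n}"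

definition Tens_deg :: "nat \<Rightarrow> tens set" where
  "Tens_deg k = {tcls M | M. set_mset M \<subseteq> E \<times> Forms_deg n k}"

definition trep :: "tens \<Rightarrow> fsum" where
  "trep X = (SOME M. M \<in> X)"

definition pure :: "emor \<Rightarrow> qform \<Rightarrow> tens" where
  "pure T \<mu> = tcls {#(T, \<mu>)#}"

definition tzero :: tens where
  "tzero = tcls {#}"

definition tadd :: "tens \<Rightarrow> tens \<Rightarrow> tens" (infixl \<open>\<boxplus>\<close> 65) where
  "X \<boxplus> Y = tcls (trep X + trep Y)"

text \<open>
  The additive extension of \<open>T \<otimes> \<mu> \<mapsto> f (T, \<mu>)\<close> to the tensor product.  It is evaluated on an
  arbitrary representative, and is only meaningful for biadditive balanced \<open>f\<close>.
\<close>

definition tlift :: "(emor \<times> qform \<Rightarrow> tens) \<Rightarrow> tens \<Rightarrow> tens" where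
  "tlift f X = tcls (\<Sum>p\<in>#trep X. trep (f p))"

definition tscale :: "complex \<Rightarrow> tens \<Rightarrow> tens" where
  "tscale c = tlift (\<lambda>(T, \<mu>). pure T (fscale c \<mu>))"

definition tmul :: "tens \<Rightarrow> qform \<Rightarrow> tens" where
  "tmul X \<nu> = tlift (\<lambda>(T, \<mu>). pure T (\<mu> \<odot> \<nu>)) X"

definition teval :: "tens \<Rightarrow> emor" where
  "teval X = (\<Sum>(T, \<mu>)\<in>#trep X. rmul T \<mu>)"

definition Upsilon :: "emor \<Rightarrow> tens" where
  "Upsilon = (\<lambda>T\<in>Mor_ad Hor. inv_into Tens teval T)"

definition metric :: "emor \<Rightarrow> emor \<Rightarrow> qform" where
  "metric T1 T2 = fstar (T1 1) \<odot> T2 1"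

definition tmetric :: "tens \<Rightarrow> tens \<Rightarrow> qform" where
  "tmetric X Y = (\<Sum>(T1, \<mu>1)\<in>#trep X. \<Sum>(T2, \<mu>2)\<in>#trep Y. fstar \<mu>1 \<odot> metric T1 T2 \<odot> \<mu>2)"


subsection \<open>Quantum linear connections and the Yang--Mills equation\<close>

definition qlc :: "(emor \<Rightarrow> tens) set" where
  "qlc = {D \<in> E \<rightarrow>\<^sub>E Tens_deg 1.
     (\<forall>T\<in>E. \<forall>T'\<in>E. D (T + T') = D T \<boxplus> D T') \<and>
     (\<forall>T\<in>E. \<forall>c. D (\<lambda>\<theta>. fscale c (T \<theta>)) = tscale c (D T)) \<and>
     (\<forall>T\<in>E. \<forall>b\<in>B. D (rmul T b) = tmul (D T) b \<boxplus> pure T (fd b))}"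

definition qlc_C :: "(emor \<Rightarrow> tens) set" where
  "qlc_C = {D \<in> qlc. \<forall>T1\<in>E. \<forall>T2\<in>E.
     tmetric (pure T1 fone) (D T2) - tmetric (D T1) (pure T2 fone) = fd (metric T1 T2)}"

definition gauge_qlc :: "emor \<Rightarrow> emor \<Rightarrow> tens" where
  "gauge_qlc \<omega> = (\<lambda>T\<in>E. Upsilon (\<lambda>\<theta>. dual_cov_deriv \<omega> (T \<theta>)))"

definition ext_d :: "(emor \<Rightarrow> tens) \<Rightarrow> tens \<Rightarrow> tens" where
  "ext_d D = tlift (\<lambda>(T, \<nu>). tmul (D T) \<nu> \<boxplus> pure T (fd \<nu>))"

definition curvature :: "(emor \<Rightarrow> tens) \<Rightarrow> emor \<Rightarrow> tens" where
  "curvature D = ext_d D \<circ> D"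

definition id_hodge :: "tens \<Rightarrow> tens" where
  "id_hodge = tlift (\<lambda>(T, \<mu>). pure T (hodge \<mu>))"

definition op_ext :: "(emor \<Rightarrow> tens) \<Rightarrow> tens \<Rightarrow> tens" where
  "op_ext \<Lambda> = tlift (\<lambda>(T, \<nu>). tmul (\<Lambda> T) \<nu>)"

text \<open>The graded commutator of \<open>D\<close> with an operator \<open>\<Lambda>\<close> raising the form degree by \<open>k\<close>.\<close>

definition commutator :: "nat \<Rightarrow> (emor \<Rightarrow> tens) \<Rightarrow> (emor \<Rightarrow> tens) \<Rightarrow> emor \<Rightarrow> tens" where
  "commutator k D \<Lambda> = (\<lambda>T. ext_d D (\<Lambda> T) \<boxplus> tscale (- ((-1) ^ k)) (op_ext \<Lambda> (D T)))"

definition YM_qlc :: "(emor \<Rightarrow> tens) set" where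
  "YM_qlc = {D \<in> qlc_C. \<forall>T\<in>E. commutator (n - 2) D (id_hodge \<circ> curvature D) T = tzero}"

end

end

theory Submission
  imports Defs
begin

text \<open>
  The corepresentation \<open>ad\<close> of the abelian group \<open>U(1)\<close> is trivial.  Therefore a morphism \<open>T\<close> in \<open>E\<close> takes
  a coinvariant value at \<open>\<vartheta>\<close>, that is, \<open>T(\<vartheta>)\<close> belongs to the base algebra, and \<open>T \<mapsto> T(\<vartheta>)\<close> makes \<open>E\<close> a free
  right module of rank one (\<open>E_frame\<close>, \<open>E_cases\<close>).  On a coinvariant form the correction term of the
  covariant derivative of \<open>\<omega>\<close> is \<open>\<omega>(\<pi>(\<one>)) = 0\<close>, so for every connection \<open>\<omega>\<close> the gauge connection is, in
  the coordinate \<open>T(\<vartheta>)\<close>, just the differential \<open>d\<close> (\<open>dual_cov_deriv_base\<close>, \<open>gauge_qlc_eq\<close>).  Its exterior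
  extension is \<open>d\<close> again, so its curvature is \<open>d d = 0\<close>, and the Yang--Mills equation holds trivially.
  The Leibniz rule and compatibility with the metric are the Leibniz rule for \<open>d\<close> and \<open>d(a\<^sup>*) = -(da)\<^sup>*\<close>.

  Two things have to be supplied.  The first is analytic: the convolution product of rapidly decaying
  series is again rapidly decaying, associative, and compatible with the derivations and the star
  operation.  This rests on the submultiplicativity of the weight \<open>1 + \<Sum> \<bar>k i\<bar>\<close> and on the
  summability of its negative powers over the lattice.  The second is algebraic: the
  tensor product of \<open>E\<close> with the base forms consists of congruence classes of formal sums, and its
  operations are evaluated on arbitrary representatives.  The coordinate \<open>T \<otimes> \<mu> \<mapsto> T(\<vartheta>) \<mu>\<close> is invariant
  under the congruence, and every formal sum is congruent to \<open>1 \<otimes> \<mu>\<close> for its coordinate \<open>\<mu>\<close>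
  (\<open>teq_invariant\<close>, \<open>teq_unit\<close>).  So \<open>\<mu> \<mapsto> 1 \<otimes> \<mu>\<close>, called \<open>tens_of\<close>, is a bijection from the base forms onto
  the tensor product, and all the operations turn into the corresponding ones on forms
  (\<open>tlift_tens_of\<close>).
\<close>

section \<open>Summation over the lattice of multi-indices\<close>

text \<open>
  Decay is measured by powers of this weight.  It is bounded below by \<open>1\<close>, submultiplicative along
  \<open>k = p + (k - p)\<close>, and a sufficiently high negative power of it is summable over the lattice;
  everything analytic in the sequel follows from these three facts.
\<close>

definition lattice_weight :: "nat \<Rightarrow> (nat \<Rightarrow> int) \<Rightarrow> real" where
  "lattice_weight m k = 1 + (\<Sum>i<m. real_of_int \<bar>k i\<bar>)"

lemma lattice_weight_ge_1: "lattice_weight m k \<ge> 1"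
  unfolding lattice_weight_def by (simp add: sum_nonneg)

lemma lattice_weight_uminus [simp]: "lattice_weight m (- k) = lattice_weight m k"
  by (simp add: lattice_weight_def)

lemma lattice_weight_component: "i < m \<Longrightarrow> 1 + \<bar>of_int (k i)\<bar> \<le> lattice_weight m k"
  unfolding lattice_weight_def
  using member_le_sum[of i "{..<m}" "\<lambda>i. real_of_int \<bar>k i\<bar>"] by simp

lemma lattice_weight_submult:
  "lattice_weight m k \<le> lattice_weight m p * lattice_weight m (k - p)"
proof -
  have "(\<Sum>i<m. real_of_int \<bar>k i\<bar>) \<le> (\<Sum>i<m. real_of_int \<bar>p i\<bar> + real_of_int \<bar>(k - p) i\<bar>)"
    by (rule sum_mono) (auto simp flip: of_int_add)
  moreover have "0 \<le> (\<Sum>i<m. real_of_int \<bar>p i\<bar>) * (\<Sum>i<m. real_of_int \<bar>(k - p) i\<bar>)"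
    by (intro mult_nonneg_nonneg sum_nonneg) auto
  ultimately show ?thesis
    unfolding lattice_weight_def sum.distrib
    by (simp only: ring_distribs mult_1_left mult_1_right)
qed

lemma lattice_pts_0 [simp]: "0 \<in> lattice_pts m"
  by (simp add: lattice_pts_def)

lemma lattice_pts_add: "p \<in> lattice_pts m \<Longrightarrow> q \<in> lattice_pts m \<Longrightarrow> p + q \<in> lattice_pts m"
  by (simp add: lattice_pts_def)

lemma lattice_pts_diff: "p \<in> lattice_pts m \<Longrightarrow> q \<in> lattice_pts m \<Longrightarrow> p - q \<in> lattice_pts m"
  by (simp add: lattice_pts_def)

lemma lattice_pts_uminus_iff [simp]: "- p \<in> lattice_pts m \<longleftrightarrow> p \<in> lattice_pts m"
  by (simp add: lattice_pts_def)

lemma lattice_pts_mono: "m \<le> l \<Longrightarrow> lattice_pts m \<subseteq> lattice_pts l"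
  by (auto simp: lattice_pts_def)

lemma summable_on_inverse_square_int:
  "(\<lambda>j::int. 1 / (1 + \<bar>of_int j\<bar>)\<^sup>2 :: real) summable_on UNIV"
proof -
  let ?g = "\<lambda>j::int. 1 / (1 + \<bar>of_int j\<bar>)\<^sup>2 :: real"
  have "summable (\<lambda>j. 1 / (1 + real j)\<^sup>2)"
  proof -
    have "summable (\<lambda>j. inverse (real (Suc j) ^ 2))"
      by (subst summable_Suc_iff) (rule inverse_power_summable, simp)
    then show ?thesis by (simp add: inverse_eq_divide)
  qed
  then have N: "(\<lambda>j::nat. 1 / (1 + real j)\<^sup>2) summable_on A" for A
    by (rule summable_on_subset_banach[OF summable_nonneg_imp_summable_on]) auto
  have "?g summable_on range int"
    by (subst summable_on_reindex) (use N in \<open>auto simp: o_def\<close>)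
  moreover have "?g summable_on (\<lambda>j. - int j) ` {1..}"
    by (subst summable_on_reindex) (use N in \<open>auto simp: o_def inj_on_def\<close>)
  ultimately have "?g summable_on range int \<union> (\<lambda>j. - int j) ` {1..}"
    by (rule summable_on_Un_disjoint) auto
  also have "range int \<union> (\<lambda>j. - int j) ` {1..} = UNIV"
  proof -
    have "j \<in> range int \<union> (\<lambda>j. - int j) ` {1..}" for j
    proof (cases "j \<ge> 0")
      case True
      then show ?thesis by (metis UnI1 nonneg_int_cases rangeI)
    next
      case False
      then have "j = - int (nat (- j))" "nat (- j) \<in> {1..}" by auto
      then show ?thesis by blast
    qed
    then show ?thesis by blast
  qed
  finally show ?thesis .
qed

text \<open>
  The weight dominates each factor \<open>1 + \<bar>k i\<bar>\<close>, so the term is at most the product of the one-dimensional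
  terms \<open>1 / (1 + \<bar>k i\<bar>)\<^sup>2\<close>.  A finite set of lattice points is contained in a box, over which that
  product sums to a product of partial sums of a convergent series.
\<close>

lemma summable_on_lattice_weight:
  "(\<lambda>k. 1 / lattice_weight m k ^ (2 * m)) summable_on lattice_pts m"
proof (rule summable_on_comparison_test)
  define g where "g j = 1 / (1 + \<bar>real_of_int j\<bar>)\<^sup>2" for j :: int
  have g0: "g j \<ge> 0" for j by (simp add: g_def)
  show "(\<lambda>k. \<Prod>i<m. g (k i)) summable_on lattice_pts m"
  proof (rule nonneg_bdd_above_summable_on)
    show "bdd_above (sum (\<lambda>k. \<Prod>i<m. g (k i)) ` {F. F \<subseteq> lattice_pts m \<and> finite F})"
    proof (rule bdd_aboveI2)
      fix F assume "F \<in> {F. F \<subseteq> lattice_pts m \<and> finite F}"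
      then have F: "F \<subseteq> lattice_pts m" "finite F" by auto
      define A where "A = (\<Union>i<m. (\<lambda>k. k i) ` F)"
      have A: "finite A" using F by (simp add: A_def)
      \<comment> \<open>Lattice points vanish from index \<open>m\<close> on, so they are determined by their restrictions, which live
        in the extensional function space that the distributivity law speaks about.\<close>
      have "inj_on (\<lambda>k. restrict k {..<m}) F"
      proof (rule inj_onI)
        fix p q assume pq: "p \<in> F" "q \<in> F" "restrict p {..<m} = restrict q {..<m}"
        show "p = q"
        proof
          fix i show "p i = q i"
          proof (cases "i < m")
            case True
            then show ?thesis using pq(3) by (metis lessThan_iff restrict_apply')
          next
            case False
            then have "p i = 0" "q i = 0" using pq F by (auto simp: lattice_pts_def)
            then show ?thesis by simp
          qed
        qed
      qed
      then have "(\<Sum>k\<in>F. \<Prod>i<m. g (k i)) = (\<Sum>k\<in>(\<lambda>k. restrict k {..<m}) ` F. \<Prod>i<m. g (k i))"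
        by (simp add: sum.reindex)
      also have "\<dots> \<le> (\<Sum>k\<in>PiE {..<m} (\<lambda>_. A). \<Prod>i<m. g (k i))"
        using F A by (intro sum_mono2 finite_PiE prod_nonneg) (auto simp: g0 A_def split: if_splits)
      also have "\<dots> = (\<Prod>i<m. \<Sum>j\<in>A. g j)"
        using A by (subst prod_sum_PiE) auto
      also have "\<dots> \<le> (\<Prod>i<m. infsum g UNIV)"
        using A g0 summable_on_inverse_square_int
        by (intro prod_mono conjI sum_nonneg finite_sum_le_infsum) (auto simp: g_def)
      finally show "(\<Sum>k\<in>F. \<Prod>i<m. g (k i)) \<le> (\<Prod>i<m. infsum g UNIV)" .
    qed
  qed (auto intro: prod_nonneg g0)
  show "1 / lattice_weight m k ^ (2 * m) \<le> (\<Prod>i<m. g (k i))" for k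
  proof -
    have "(\<Prod>i<m. 1 / (lattice_weight m k)\<^sup>2) \<le> (\<Prod>i<m. g (k i))"
      unfolding g_def
    proof (intro prod_mono conjI)
      fix i assume "i \<in> {..<m}"
      then show "1 / (lattice_weight m k)\<^sup>2 \<le> 1 / (1 + \<bar>real_of_int (k i)\<bar>)\<^sup>2"
        using lattice_weight_component[of i m k] by (intro divide_left_mono power_mono) (auto simp: power2_eq_square)
    qed auto
    then show ?thesis by (simp add: power_mult power_one_over)
  qed
qed (use lattice_weight_ge_1 in \<open>auto intro!: divide_nonneg_nonneg zero_le_power order_trans[OF _ lattice_weight_ge_1]\<close>)


section \<open>Rapidly decaying series\<close>

lemma qtorus_iff:
  "x \<in> qtorus m \<longleftrightarrow> (\<forall>k. k \<notin> lattice_pts m \<longrightarrow> x k = 0) \<and>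
     (\<forall>N. \<exists>C. \<forall>k. lattice_weight m k ^ N * norm (x k) \<le> C)"
  by (simp add: qtorus_def lattice_weight_def)

lemma qtorus_outside: "x \<in> qtorus m \<Longrightarrow> k \<notin> lattice_pts m \<Longrightarrow> x k = 0"
  by (simp add: qtorus_iff)

lemma qtorus_bound:
  assumes "x \<in> qtorus m"
  obtains C where "C \<ge> 0" "\<And>k. lattice_weight m k ^ N * norm (x k) \<le> C"
proof -
  obtain C where C: "lattice_weight m k ^ N * norm (x k) \<le> C" for k
    using assms unfolding qtorus_iff by metis
  have "0 \<le> lattice_weight m 0 ^ N * norm (x 0)"
    using lattice_weight_ge_1[of m 0] by simp
  with C[of 0] have "C \<ge> 0" by linarith
  with C show thesis using that by blast
qed

lemma qtorus_0 [simp]: "0 \<in> qtorus m"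
  by (auto simp: qtorus_iff intro: exI[of _ 0])

lemma qtorus_qmonom [simp]: "p \<in> lattice_pts m \<Longrightarrow> qmonom p \<in> qtorus m"
proof -
  assume "p \<in> lattice_pts m"
  moreover have "lattice_weight m k ^ N * norm (qmonom p k) \<le> lattice_weight m p ^ N" for k N
    using lattice_weight_ge_1[of m p] by (simp add: qmonom_def)
  ultimately show ?thesis by (auto simp: qtorus_iff) (auto simp: qmonom_def)
qed

lemma qtorus_add [intro]:
  assumes "x \<in> qtorus m" "y \<in> qtorus m" shows "x + y \<in> qtorus m"
  unfolding qtorus_iff
proof (intro conjI allI impI)
  fix N
  obtain C where C: "\<And>k. lattice_weight m k ^ N * norm (x k) \<le> C"
    using qtorus_bound[OF assms(1)] by metis
  obtain C' where C': "\<And>k. lattice_weight m k ^ N * norm (y k) \<le> C'"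
    using qtorus_bound[OF assms(2)] by metis
  have "lattice_weight m k ^ N * norm ((x + y) k) \<le> C + C'" for k
  proof -
    have "lattice_weight m k ^ N * norm ((x + y) k) \<le> lattice_weight m k ^ N * (norm (x k) + norm (y k))"
      using lattice_weight_ge_1[of m k] by (intro mult_left_mono) (auto simp: norm_triangle_ineq)
    also have "\<dots> \<le> C + C'" using C[of k] C'[of k] by (simp add: distrib_left)
    finally show ?thesis .
  qed
  then show "\<exists>C. \<forall>k. lattice_weight m k ^ N * norm ((x + y) k) \<le> C" by blast
qed (use assms in \<open>simp add: qtorus_outside\<close>)

lemma qtorus_scale:
  assumes "x \<in> qtorus m" shows "(\<lambda>k. c * x k) \<in> qtorus m"
  unfolding qtorus_iff
proof (intro conjI allI impI)
  fix N
  obtain C where C: "\<And>k. lattice_weight m k ^ N * norm (x k) \<le> C"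
    using qtorus_bound[OF assms(1)] by metis
  have "lattice_weight m k ^ N * norm (c * x k) \<le> norm c * C" for k
    using mult_left_mono[OF C[of k], of "norm c"] by (simp add: norm_mult mult_ac)
  then show "\<exists>C. \<forall>k. lattice_weight m k ^ N * norm (c * x k) \<le> C" by blast
qed (use assms in \<open>simp add: qtorus_outside\<close>)

lemma qtorus_sum: "(\<And>i. i \<in> A \<Longrightarrow> x i \<in> qtorus m) \<Longrightarrow> (\<Sum>i\<in>A. x i) \<in> qtorus m"
  by (induction A rule: infinite_finite_induct) auto

text \<open>
  A derivation multiplies the coefficients by something at most proportional to the weight, so it
  costs one power of decay.
\<close>

lemma qtorus_qderiv [intro]:
  assumes "x \<in> qtorus m" shows "qderiv j x \<in> qtorus m"
  unfolding qtorus_iff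
proof (intro conjI allI impI)
  fix N
  obtain C where C: "C \<ge> 0" "\<And>k. lattice_weight m k ^ Suc N * norm (x k) \<le> C"
    using qtorus_bound[OF assms(1)] by metis
  have "lattice_weight m k ^ N * norm (qderiv j x k) \<le> 2 * pi * C" for k
  proof (cases "j < m \<or> k \<notin> lattice_pts m")
    case True
    have "norm (qderiv j x k) \<le> 2 * pi * (lattice_weight m k * norm (x k))"
    proof (cases "k \<in> lattice_pts m")
      case True
      then have "j < m" using \<open>j < m \<or> _\<close> by simp
      then have "\<bar>of_int (k j)\<bar> \<le> lattice_weight m k"
        using lattice_weight_component[of j m k] by simp
      then have "\<bar>of_int (k j)\<bar> * (2 * pi * norm (x k)) \<le> lattice_weight m k * (2 * pi * norm (x k))"
        by (intro mult_right_mono) auto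
      then show ?thesis by (simp add: qderiv_def norm_mult mult_ac)
    qed (use assms in \<open>simp add: qderiv_def qtorus_outside\<close>)
    then have "lattice_weight m k ^ N * norm (qderiv j x k)
      \<le> lattice_weight m k ^ N * (2 * pi * (lattice_weight m k * norm (x k)))"
      using lattice_weight_ge_1[of m k] by (intro mult_left_mono) auto
    also have "\<dots> = 2 * pi * (lattice_weight m k ^ Suc N * norm (x k))" by (simp add: mult_ac)
    also have "\<dots> \<le> 2 * pi * C" using C(2) by (intro mult_left_mono) auto
    finally show ?thesis .
  next
    case False
    then have "qderiv j x k = 0" by (simp add: qderiv_def lattice_pts_def)
    then show ?thesis using C by simp
  qed
  then show "\<exists>C. \<forall>k. lattice_weight m k ^ N * norm (qderiv j x k) \<le> C" by blast
qed (use assms in \<open>simp add: qderiv_def qtorus_outside\<close>)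

text \<open>
  Spending \<open>2 * m\<close> powers of decay on the summable majorant leaves any prescribed number \<open>N\<close> of them.
\<close>

lemma qtorus_abs_summable:
  assumes "x \<in> qtorus m"
  shows "(\<lambda>p. lattice_weight m p ^ N * norm (x p)) summable_on A"
proof -
  obtain C where C: "\<And>k. lattice_weight m k ^ (2 * m + N) * norm (x k) \<le> C"
    using qtorus_bound[OF assms(1)] by metis
  have w: "lattice_weight m k > 0" for k using lattice_weight_ge_1[of m k] by linarith
  have "(\<lambda>p. lattice_weight m p ^ N * norm (x p)) summable_on lattice_pts m"
  proof (rule summable_on_comparison_test)
    show "(\<lambda>k. C * (1 / lattice_weight m k ^ (2 * m))) summable_on lattice_pts m"
      by (intro summable_on_cmult_right summable_on_lattice_weight)
    show "lattice_weight m k ^ N * norm (x k) \<le> C * (1 / lattice_weight m k ^ (2 * m))" for k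
      using C[of k] w[of k] by (simp add: field_simps power_add)
    show "0 \<le> lattice_weight m k ^ N * norm (x k)" for k using w[of k] by simp
  qed
  then have "(\<lambda>p. lattice_weight m p ^ N * norm (x p)) summable_on UNIV"
    by (rule summable_on_cong_neutral[THEN iffD1, rotated -1]) (use assms in \<open>auto simp: qtorus_outside\<close>)
  then show ?thesis by (rule summable_on_subset_banach) simp
qed

lemma qtorus_norm_summable:
  assumes "x \<in> qtorus m" shows "(\<lambda>p. norm (x p)) summable_on A"
  using qtorus_abs_summable[OF assms, of 0] by simp

lemma qtorus_norm_bound:
  assumes "x \<in> qtorus m" obtains C where "C \<ge> 0" "\<And>k. norm (x k) \<le> C"
  using qtorus_bound[OF assms, of 0] by (metis mult_1 power_0)

lemma qtorus_mono:
  assumes "x \<in> qtorus m" "m \<le> l" shows "x \<in> qtorus l"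
  unfolding qtorus_iff
proof (intro conjI allI impI)
  fix k assume "k \<notin> lattice_pts l"
  then show "x k = 0" using assms lattice_pts_mono by (blast intro: qtorus_outside)
next
  fix N
  obtain C where C: "C \<ge> 0" "\<And>k. lattice_weight m k ^ N * norm (x k) \<le> C"
    using qtorus_bound[OF assms(1)] by metis
  have "lattice_weight l k ^ N * norm (x k) \<le> C" for k
  proof (cases "k \<in> lattice_pts m")
    case True
    then have "lattice_weight l k = lattice_weight m k"
      using assms(2) unfolding lattice_weight_def
      by (intro arg_cong[where f = "\<lambda>t. 1 + t"] sum.mono_neutral_right) (auto simp: lattice_pts_def)
    then show ?thesis using C by simp
  next
    case False
    then show ?thesis using C assms by (simp add: qtorus_outside)
  qed
  then show "\<exists>C. \<forall>k. lattice_weight l k ^ N * norm (x k) \<le> C" by blast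
qed

text \<open>
  This identifies the coinvariant elements of the total space: the coefficients of such an element
  are concentrated on the multi-indices without a fibre component.
\<close>

lemma qtorus_restrict:
  assumes "x \<in> qtorus (Suc m)" "\<And>k. k m \<noteq> 0 \<Longrightarrow> x k = 0" shows "x \<in> qtorus m"
  unfolding qtorus_iff
proof (intro conjI allI impI)
  fix k assume "k \<notin> lattice_pts m"
  then obtain i where i: "i \<ge> m" "k i \<noteq> 0" by (auto simp: lattice_pts_def)
  show "x k = 0"
  proof (cases "i = m")
    case False
    then have "i \<ge> Suc m" using i by simp
    then have "k \<notin> lattice_pts (Suc m)" using i unfolding lattice_pts_def by blast
    then show ?thesis using assms by (simp add: qtorus_outside)
  qed (use i assms in auto)
next
  fix N
  obtain C where C: "C \<ge> 0" "\<And>k. lattice_weight (Suc m) k ^ N * norm (x k) \<le> C"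
    using qtorus_bound[OF assms(1)] by metis
  have "lattice_weight m k ^ N * norm (x k) \<le> C" for k
  proof -
    have "lattice_weight m k ^ N * norm (x k) \<le> lattice_weight (Suc m) k ^ N * norm (x k)"
      using lattice_weight_ge_1[of m k]
      by (intro mult_right_mono power_mono) (auto simp: lattice_weight_def)
    then show ?thesis using C(2)[of k] by linarith
  qed
  then show "\<exists>C. \<forall>k. lattice_weight m k ^ N * norm (x k) \<le> C" by blast
qed

context quantum_torus_bundle
begin

section \<open>The algebra of a quantum torus\<close>

text \<open>
  The cocycle is the exponential of a bilinear form, so every identity between products of cocycles
  below is an additive identity between values of this form.
\<close>

definition cocycle_form :: "(nat \<Rightarrow> int) \<Rightarrow> (nat \<Rightarrow> int) \<Rightarrow> real" where
  "cocycle_form k l = 2 * pi * (\<Sum>i\<le>n. \<Sum>j<i. \<Xi> i j * of_int (k i) * of_int (l j))"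

lemma cocycle_eq_cis: "cocycle k l = cis (cocycle_form k l)"
  by (simp add: cocycle_def cocycle_form_def)

lemma cocycle_form_add_left: "cocycle_form (k + k') l = cocycle_form k l + cocycle_form k' l"
  by (simp add: cocycle_form_def sum.distrib algebra_simps)

lemma cocycle_form_add_right: "cocycle_form k (l + l') = cocycle_form k l + cocycle_form k l'"
  by (simp add: cocycle_form_def sum.distrib algebra_simps)

lemma cocycle_form_uminus_left: "cocycle_form (- k) l = - cocycle_form k l"
  by (simp add: cocycle_form_def sum_negf)

lemma cocycle_form_uminus_right: "cocycle_form k (- l) = - cocycle_form k l"
  by (simp add: cocycle_form_def sum_negf)

lemma cocycle_form_diff_left: "cocycle_form (k - k') l = cocycle_form k l - cocycle_form k' l"
  by (simp add: cocycle_form_add_left[of k "- k'", simplified] cocycle_form_uminus_left)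

lemma cocycle_form_diff_right: "cocycle_form k (l - l') = cocycle_form k l - cocycle_form k l'"
  by (simp add: cocycle_form_add_right[of k _ "- l'", simplified] cocycle_form_uminus_right)

lemmas cocycle_form_bilinear =
  cocycle_form_add_left cocycle_form_add_right cocycle_form_uminus_left cocycle_form_uminus_right
  cocycle_form_diff_left cocycle_form_diff_right

lemma norm_cocycle [simp]: "norm (cocycle k l) = 1"
  by (simp add: cocycle_eq_cis)

lemma cocycle_0_left [simp]: "cocycle 0 l = 1" and cocycle_0_right [simp]: "cocycle k 0 = 1"
  by (simp_all add: cocycle_def)

lemma qmul_abs_summable:
  assumes "x \<in> qtorus m" "y \<in> qtorus m'"
  shows "(\<lambda>p. norm (cocycle p (k - p) * x p * y (k - p))) summable_on A"
proof -
  obtain C where C: "\<And>k. norm (y k) \<le> C" using qtorus_norm_bound[OF assms(2)] by metis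
  show ?thesis
  proof (rule Infinite_Sum.abs_summable_on_comparison_test')
    show "(\<lambda>p. C * norm (x p)) summable_on A"
      by (intro summable_on_cmult_right qtorus_norm_summable[OF assms(1)])
    show "norm (cocycle p (k - p) * x p * y (k - p)) \<le> C * norm (x p)" for p
      using mult_right_mono[OF C[of "k - p"], of "norm (x p)"] by (simp add: norm_mult mult_ac)
  qed
qed

lemmas qmul_summable = qmul_abs_summable[THEN Infinite_Sum.abs_summable_summable]

lemma qmul_add_left:
  assumes "x \<in> qtorus m" "x' \<in> qtorus m" "y \<in> qtorus m"
  shows "qmul (x + x') y = qmul x y + qmul x' y"
  by (rule ext) (simp add: qmul_def ring_distribs infsum_add qmul_summable[OF assms(1,3)]
      qmul_summable[OF assms(2,3)])

lemma qmul_add_right: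
  assumes "x \<in> qtorus m" "y \<in> qtorus m" "y' \<in> qtorus m"
  shows "qmul x (y + y') = qmul x y + qmul x y'"
  by (rule ext) (simp add: qmul_def ring_distribs infsum_add qmul_summable[OF assms(1,2)]
      qmul_summable[OF assms(1,3)])

lemma qmul_0_left [simp]: "qmul 0 y = 0" and qmul_0_right [simp]: "qmul x 0 = 0"
  by (simp_all add: qmul_def fun_eq_iff)

lemma qmul_one_left [simp]:
  assumes "x \<in> qtorus m" shows "qmul (qmonom 0) x = x"
proof
  fix k
  have "qmul (qmonom 0) x k = infsum (\<lambda>p. cocycle p (k - p) * qmonom 0 p * x (k - p)) {0}"
    unfolding qmul_def by (rule infsum_cong_neutral) (auto simp: qmonom_def)
  then show "qmul (qmonom 0) x k = x k" by (simp add: qmonom_def)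
qed

lemma qmul_one_right:
  assumes "x \<in> qtorus m" "m \<le> Suc n" shows "qmul x (qmonom 0) = x"
proof
  fix k
  have x: "x \<in> qtorus (Suc n)" using assms by (rule qtorus_mono)
  have "qmul x (qmonom 0) k = infsum (\<lambda>p. cocycle p (k - p) * x p * qmonom 0 (k - p)) {k}"
    unfolding qmul_def
    by (rule infsum_cong_neutral) (use x in \<open>auto simp: qmonom_def qtorus_outside fun_eq_iff\<close>)
  then show "qmul x (qmonom 0) k = x k" by (simp add: qmonom_def)
qed

text \<open>
  By submultiplicativity \<open>w k ^ N \<le> w p ^ N * w (k - p) ^ N\<close>, the convolution with all its decay is
  dominated by the convolution of the decaying series: one factor is bounded, the other summable.
\<close>

lemma qtorus_qmul:
  assumes x: "x \<in> qtorus m" and y: "y \<in> qtorus m"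
  shows "qmul x y \<in> qtorus m"
  unfolding qtorus_iff
proof (intro conjI allI impI)
  fix k assume k: "k \<notin> lattice_pts m"
  have "x p * y (k - p) = 0" for p
    using lattice_pts_add[of p m "k - p"] k qtorus_outside[OF x, of p] qtorus_outside[OF y, of "k - p"] by auto
  then show "qmul x y k = 0"
    by (simp only: qmul_def mult.assoc mult_zero_right infsum_0_simp)
next
  fix N
  let ?L = "lattice_pts (Suc n)" and ?w = "lattice_weight m"
  obtain C where C: "C \<ge> 0" "\<And>k. ?w k ^ N * norm (y k) \<le> C" using qtorus_bound[OF y] by metis
  let ?S = "\<Sum>\<^sub>\<infinity>p\<in>?L. ?w p ^ N * norm (x p)"
  have "?w k ^ N * norm (qmul x y k) \<le> C * ?S" for k
  proof -
    let ?f = "\<lambda>p. ?w k ^ N * (cocycle p (k - p) * x p * y (k - p))"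
    have w: "?w p > 0" for p using lattice_weight_ge_1[of m p] by linarith
    have bound: "norm (?f p) \<le> C * (?w p ^ N * norm (x p))" for p
    proof -
      have "norm (?f p) = ?w k ^ N * (norm (x p) * norm (y (k - p)))"
        using w[of k] by (simp add: norm_mult norm_power)
      also have "\<dots> \<le> (?w p * ?w (k - p)) ^ N * (norm (x p) * norm (y (k - p)))"
        using w[of k] lattice_weight_submult by (intro mult_right_mono power_mono) (auto intro: less_imp_le)
      also have "\<dots> = (?w p ^ N * norm (x p)) * (?w (k - p) ^ N * norm (y (k - p)))"
        by (simp add: power_mult_distrib mult_ac)
      also have "\<dots> \<le> (?w p ^ N * norm (x p)) * C"
        using w[of p] by (intro mult_left_mono C(2)) auto
      finally show ?thesis by (simp add: mult.commute)
    qed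
    have "norm (infsum ?f ?L) \<le> (\<Sum>\<^sub>\<infinity>p\<in>?L. C * (?w p ^ N * norm (x p)))"
    proof (rule norm_infsum_le)
      show "(?f has_sum infsum ?f ?L) ?L"
        by (intro has_sum_infsum summable_on_cmult_right qmul_summable[OF x y])
      show "((\<lambda>p. C * (?w p ^ N * norm (x p))) has_sum (\<Sum>\<^sub>\<infinity>p\<in>?L. C * (?w p ^ N * norm (x p)))) ?L"
        by (intro has_sum_infsum summable_on_cmult_right qtorus_abs_summable[OF x])
    qed (rule bound)
    also have "(\<Sum>\<^sub>\<infinity>p\<in>?L. C * (?w p ^ N * norm (x p))) = C * ?S"
      by (simp add: infsum_cmult_right')
    finally show ?thesis
      using w[of k] by (simp add: qmul_def infsum_cmult_right' norm_mult norm_power)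
  qed
  then show "\<exists>C. \<forall>k. ?w k ^ N * norm (qmul x y k) \<le> C" by blast
qed

text \<open>
  Both sides are double sums over \<open>x p * y r * z (k - p - r)\<close>, after the substitution \<open>r = q - p\<close>.
  Their phases agree because the form is bilinear, and the order of summation may be exchanged
  because \<open>x\<close> and \<open>y\<close> are absolutely summable and \<open>z\<close> is bounded.
\<close>

lemma qmul_assoc:
  assumes "x \<in> qtorus m" "y \<in> qtorus m" "z \<in> qtorus m" and m: "m \<le> Suc n"
  shows "qmul (qmul x y) z = qmul x (qmul y z)"
proof
  fix k
  let ?L = "lattice_pts (Suc n)"
  have x: "x \<in> qtorus (Suc n)" and y: "y \<in> qtorus (Suc n)" and z: "z \<in> qtorus (Suc n)"
    using assms by (auto intro: qtorus_mono)
  define f where "f q p = cocycle q (k - q) * cocycle p (q - p) * x p * y (q - p) * z (k - q)" for q p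
  have f_eq: "f q p = cocycle p (k - p) * cocycle (q - p) (k - q) * x p * y (q - p) * z (k - q)" for q p
  proof -
    have "cocycle q (k - q) * cocycle p (q - p) = cocycle p (k - p) * cocycle (q - p) (k - q)"
      by (simp add: cocycle_eq_cis cis_mult cocycle_form_bilinear algebra_simps)
    then show ?thesis by (simp only: f_def)
  qed
  obtain C where C: "C \<ge> 0" "\<And>k. norm (z k) \<le> C" using qtorus_norm_bound[OF z] by metis
  have "(\<lambda>(p, r). norm (x p * y r)) summable_on ?L \<times> ?L"
  proof (rule summable_on_SigmaI)
    show "((\<lambda>r. case (p, r) of (p, r) \<Rightarrow> norm (x p * y r)) has_sum norm (x p) * (\<Sum>\<^sub>\<infinity>r\<in>?L. norm (y r))) ?L" for p
      unfolding case_prod_conv norm_mult by (intro has_sum_cmult_right has_sum_infsum qtorus_norm_summable[OF y])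
    show "(\<lambda>p. norm (x p) * (\<Sum>\<^sub>\<infinity>r\<in>?L. norm (y r))) summable_on ?L"
      by (intro summable_on_cmult_left qtorus_norm_summable[OF x])
  qed auto
  then have "(\<lambda>(q, p). norm (x p * y (q - p))) summable_on ?L \<times> ?L"
    by (subst summable_on_reindex_bij_witness[of _ "\<lambda>(p, r). (p + r, p)" "\<lambda>(q, p). (p, q - p)" "?L \<times> ?L"
        "\<lambda>(p, r). norm (x p * y r)"]) (auto simp: lattice_pts_add lattice_pts_diff case_prod_unfold)
  then have "(\<lambda>t. norm (case t of (q, p) \<Rightarrow> f q p)) summable_on ?L \<times> ?L"
  proof (rule Infinite_Sum.abs_summable_on_comparison_test'[OF summable_on_cmult_right[where c = C]])
    show "norm (case t of (q, p) \<Rightarrow> f q p) \<le> C * (case t of (q, p) \<Rightarrow> norm (x p * y (q - p)))" for t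
      using mult_right_mono[OF C(2)[of "k - fst t"], of "norm (x (snd t)) * norm (y (fst t - snd t))"]
      by (simp add: f_def norm_mult mult_ac case_prod_unfold)
  qed
  then have sum: "(\<lambda>(q, p). f q p) summable_on ?L \<times> ?L" by (rule Infinite_Sum.abs_summable_summable)
  have "qmul (qmul x y) z k = (\<Sum>\<^sub>\<infinity>q\<in>?L. \<Sum>\<^sub>\<infinity>p\<in>?L. f q p)"
    by (simp add: qmul_def f_def infsum_cmult_right'[symmetric] infsum_cmult_left'[symmetric] mult_ac)
  also have "\<dots> = (\<Sum>\<^sub>\<infinity>p\<in>?L. \<Sum>\<^sub>\<infinity>q\<in>?L. f q p)"
    by (rule infsum_swap_banach[OF sum])
  also have "\<dots> = (\<Sum>\<^sub>\<infinity>p\<in>?L. \<Sum>\<^sub>\<infinity>r\<in>?L. cocycle p (k - p) * cocycle r (k - p - r) * x p * y r * z (k - p - r))"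
  proof (rule infsum_cong)
    fix p assume "p \<in> ?L"
    then show "(\<Sum>\<^sub>\<infinity>q\<in>?L. f q p)
      = (\<Sum>\<^sub>\<infinity>r\<in>?L. cocycle p (k - p) * cocycle r (k - p - r) * x p * y r * z (k - p - r))"
      by (intro infsum_reindex_bij_witness[of _ "\<lambda>r. p + r" "\<lambda>q. q - p"])
         (auto simp: lattice_pts_add lattice_pts_diff f_eq)
  qed
  also have "\<dots> = qmul x (qmul y z) k"
    by (simp add: qmul_def infsum_cmult_right'[symmetric] mult_ac)
  finally show "qmul (qmul x y) z k = qmul x (qmul y z) k" .
qed

text \<open>
  The factor \<open>k j\<close> splits as \<open>p j + (k - p) j\<close> in each term of the convolution.
\<close>

lemma qderiv_qmul:
  assumes "x \<in> qtorus m" "y \<in> qtorus m"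
  shows "qderiv j (qmul x y) = qmul (qderiv j x) y + qmul x (qderiv j y)"
proof
  fix k
  let ?L = "lattice_pts (Suc n)"
  have "qmul (qderiv j x) y k + qmul x (qderiv j y) k =
    (\<Sum>\<^sub>\<infinity>p\<in>?L. cocycle p (k - p) * qderiv j x p * y (k - p) + cocycle p (k - p) * x p * qderiv j y (k - p))"
    unfolding qmul_def
    by (rule infsum_add[symmetric]; rule qmul_summable[of _ m _ m]) (use assms in auto)
  also have "\<dots> = (\<Sum>\<^sub>\<infinity>p\<in>?L. 2 * of_real pi * \<i> * of_int (k j) * (cocycle p (k - p) * x p * y (k - p)))"
    by (rule infsum_cong) (simp add: qderiv_def algebra_simps)
  also have "\<dots> = qderiv j (qmul x y) k"
    by (simp add: qderiv_def qmul_def infsum_cmult_right')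
  finally show "qderiv j (qmul x y) k = (qmul (qderiv j x) y + qmul x (qderiv j y)) k" by simp
qed

lemma qderiv_qstar: "qderiv j (qstar x) = qstar (qderiv j x)"
  by (rule ext) (simp add: qderiv_def qstar_def)

lemma qtorus_qstar [intro]:
  assumes "x \<in> qtorus m" shows "qstar x \<in> qtorus m"
  unfolding qtorus_iff
proof (intro conjI allI impI)
  fix N
  obtain C where C: "\<And>k. lattice_weight m k ^ N * norm (x k) \<le> C"
    using qtorus_bound[OF assms(1)] by metis
  have "lattice_weight m k ^ N * norm (qstar x k) \<le> C" for k
    using C[of "- k"] by (simp add: qstar_def norm_mult)
  then show "\<exists>C. \<forall>k. lattice_weight m k ^ N * norm (qstar x k) \<le> C" by blast
qed (use assms in \<open>simp add: qtorus_outside qstar_def\<close>)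

text \<open>
  The substitution \<open>p = q - k\<close> turns one convolution into the other; the phases agree by bilinearity.
  It is a bijection of the lattice only for \<open>k\<close> in the lattice; elsewhere both sides vanish.
\<close>

lemma qstar_qmul:
  assumes "x \<in> qtorus m" "y \<in> qtorus m" "m \<le> Suc n"
  shows "qstar (qmul x y) = qmul (qstar y) (qstar x)"
proof
  fix k
  let ?L = "lattice_pts (Suc n)"
  have x: "x \<in> qtorus (Suc n)" and y: "y \<in> qtorus (Suc n)"
    using assms by (auto intro: qtorus_mono)
  show "qstar (qmul x y) k = qmul (qstar y) (qstar x) k"
  proof (cases "k \<in> ?L")
    case False
    then show ?thesis
      using qtorus_qstar[OF qtorus_qmul[OF x y]] qtorus_qmul[OF qtorus_qstar[OF y] qtorus_qstar[OF x]]
      by (simp add: qtorus_outside)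
  next
    case True
    have "qmul (qstar y) (qstar x) k
      = (\<Sum>\<^sub>\<infinity>q\<in>?L. cnj (cocycle (- k) k) * cnj (cocycle (q - k) (- q) * x (q - k) * y (- q)))"
      unfolding qmul_def
    proof (rule infsum_cong)
      fix q
      have "cocycle q (k - q) * cnj (cocycle (- q) q) * cnj (cocycle (- (k - q)) (k - q))
        = cnj (cocycle (- k) k) * cnj (cocycle (q - k) (- q))"
        by (simp add: cocycle_eq_cis cis_mult cis_cnj cocycle_form_bilinear algebra_simps)
      then show "cocycle q (k - q) * qstar y q * qstar x (k - q)
        = cnj (cocycle (- k) k) * cnj (cocycle (q - k) (- q) * x (q - k) * y (- q))"
        by (simp add: qstar_def mult_ac)
    qed
    also have "\<dots> = cnj (cocycle (- k) k) * cnj (\<Sum>\<^sub>\<infinity>q\<in>?L. cocycle (q - k) (- q) * x (q - k) * y (- q))"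
      by (simp only: infsum_cmult_right' infsum_cnj)
    also have "(\<Sum>\<^sub>\<infinity>q\<in>?L. cocycle (q - k) (- q) * x (q - k) * y (- q)) = qmul x y (- k)"
      unfolding qmul_def
      by (rule infsum_reindex_bij_witness[of _ "\<lambda>p. p + k" "\<lambda>q. q - k"])
         (use True in \<open>auto simp: lattice_pts_add lattice_pts_diff\<close>)
    finally show ?thesis by (simp only: qstar_def mult.commute)
  qed
qed

lemma qstar_add: "qstar (x + y) = qstar x + qstar y"
  by (rule ext) (simp add: qstar_def ring_distribs)

lemma qstar_0 [simp]: "qstar 0 = 0"
  by (rule ext) (simp add: qstar_def)

lemma qstar_scale: "qstar (\<lambda>k. c * x k) = (\<lambda>k. cnj c * qstar x k)"
  by (rule ext) (simp add: qstar_def)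

lemma qmul_sum_left:
  assumes "\<And>i. i \<in> A \<Longrightarrow> x i \<in> qtorus m" "y \<in> qtorus m"
  shows "qmul (\<Sum>i\<in>A. x i) y = (\<Sum>i\<in>A. qmul (x i) y)"
  using assms(1)
proof (induction A rule: infinite_finite_induct)
  case (insert a A)
  then have *: "x a \<in> qtorus m" "sum x A \<in> qtorus m" by (auto intro: qtorus_sum)
  have IH: "qmul (sum x A) y = (\<Sum>i\<in>A. qmul (x i) y)" using insert by auto
  show ?case
    by (simp only: sum.insert[OF insert.hyps] qmul_add_left[OF * assms(2)] IH)
qed auto

lemma qmul_sum_right:
  assumes "\<And>i. i \<in> A \<Longrightarrow> y i \<in> qtorus m" "x \<in> qtorus m"
  shows "qmul x (\<Sum>i\<in>A. y i) = (\<Sum>i\<in>A. qmul x (y i))"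
  using assms(1)
proof (induction A rule: infinite_finite_induct)
  case (insert a A)
  then have *: "y a \<in> qtorus m" "sum y A \<in> qtorus m" by (auto intro: qtorus_sum)
  have IH: "qmul x (sum y A) = (\<Sum>i\<in>A. qmul x (y i))" using insert by auto
  show ?case
    by (simp only: sum.insert[OF insert.hyps] qmul_add_right[OF assms(2) *] IH)
qed auto

section \<open>Differential forms\<close>

text \<open>
  Scalar multiplication has its own constant so that rewriting does not look inside the abstraction.
\<close>

definition qscale :: "complex \<Rightarrow> qt \<Rightarrow> qt" where
  "qscale c x = (\<lambda>k. c * x k)"

lemma qtorus_qscale [intro]: "x \<in> qtorus m \<Longrightarrow> qscale c x \<in> qtorus m"
  unfolding qscale_def by (rule qtorus_scale)

lemma qscale_simps [simp]: "qscale c 0 = 0" "qscale 0 x = 0" "qscale 1 x = x"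
  "qscale c (qscale c' x) = qscale (c * c') x"
  by (simp_all add: qscale_def fun_eq_iff)

lemma qscale_add: "qscale c (x + y) = qscale c x + qscale c y"
  by (rule ext) (simp add: qscale_def ring_distribs)

lemma qscale_sum: "qscale c (\<Sum>i\<in>A. x i) = (\<Sum>i\<in>A. qscale c (x i))"
  by (induction A rule: infinite_finite_induct) (simp_all add: qscale_add del: plus_fun_apply zero_fun_apply)

lemma sum_fun_apply: "(\<Sum>i\<in>A. f i) x = (\<Sum>i\<in>A. f i x)"
  by (induction A rule: infinite_finite_induct) auto

lemma qmul_qscale: "qmul (qscale c x) y = qscale c (qmul x y)"
    "qmul x (qscale c y) = qscale c (qmul x y)"
  by (simp_all add: qscale_def qmul_scale_left qmul_scale_right)

lemma fscale_eq: "fscale c \<mu> = (\<lambda>I. qscale c (\<mu> I))"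
  by (simp add: fscale_def qscale_def)

lemma fmul_apply: "(\<mu> \<odot> \<nu>) K = (\<Sum>I\<in>Pow K. qscale (wsign I (K - I)) (qmul (\<mu> I) (\<nu> (K - I))))"
  by (rule ext) (simp add: fmul_def qscale_def sum_fun_apply)

lemma Forms_iff: "\<mu> \<in> Forms m \<longleftrightarrow> (\<forall>I. \<mu> I \<in> qtorus m) \<and> (\<forall>I. \<not> I \<subseteq> {..<m} \<longrightarrow> \<mu> I = 0)"
proof
  assume \<mu>: "\<mu> \<in> Forms m"
  have "\<mu> I \<in> qtorus m" for I
    using \<mu> qtorus_0[of m] unfolding Forms_def by (cases "I \<subseteq> {..<m}") simp_all
  then show "(\<forall>I. \<mu> I \<in> qtorus m) \<and> (\<forall>I. \<not> I \<subseteq> {..<m} \<longrightarrow> \<mu> I = 0)"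
    using \<mu> by (simp add: Forms_def)
qed (simp add: Forms_def)

lemma Forms_qtorus: "\<mu> \<in> Forms m \<Longrightarrow> \<mu> I \<in> qtorus m"
  by (simp add: Forms_iff)

lemma Forms_outside: "\<mu> \<in> Forms m \<Longrightarrow> \<not> I \<subseteq> {..<m} \<Longrightarrow> \<mu> I = 0"
  by (simp add: Forms_iff)

lemma Forms_infinite: "\<mu> \<in> Forms m \<Longrightarrow> infinite I \<Longrightarrow> \<mu> I = 0"
  using finite_subset by (blast intro: Forms_outside)

lemma Forms_0 [simp]: "0 \<in> Forms m"
  by (simp add: Forms_iff)

lemma Forms_add [intro]: "\<mu> \<in> Forms m \<Longrightarrow> \<nu> \<in> Forms m \<Longrightarrow> \<mu> + \<nu> \<in> Forms m"
  by (auto simp: Forms_iff)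

lemma Forms_fscale [intro]: "\<mu> \<in> Forms m \<Longrightarrow> fscale c \<mu> \<in> Forms m"
  by (auto simp: Forms_iff fscale_eq)

lemma Forms_deg0 [simp]: "deg0 a \<in> Forms m \<longleftrightarrow> a \<in> qtorus m"
  by (auto simp: Forms_iff deg0_def)

lemma Forms_dU [simp]: "I \<subseteq> {..<m} \<Longrightarrow> dU I \<in> Forms m"
  by (auto simp: Forms_iff dU_def)

lemma Forms_fmul:
  assumes "\<mu> \<in> Forms m" "\<nu> \<in> Forms m" shows "\<mu> \<odot> \<nu> \<in> Forms m"
  unfolding Forms_iff
proof (intro conjI allI impI)
  show "(\<mu> \<odot> \<nu>) K \<in> qtorus m" for K
    unfolding fmul_apply by (intro qtorus_sum qtorus_qscale qtorus_qmul Forms_qtorus assms)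
  fix K :: "nat set" assume K: "\<not> K \<subseteq> {..<m}"
  have "qmul (\<mu> I) (\<nu> (K - I)) = 0" if "I \<in> Pow K" for I
  proof -
    have "\<not> I \<subseteq> {..<m} \<or> \<not> K - I \<subseteq> {..<m}" using K that by auto
    then show ?thesis
    proof
      assume "\<not> I \<subseteq> {..<m}"
      from Forms_outside[OF assms(1) this] show ?thesis by (simp only: qmul_0_left)
    next
      assume "\<not> K - I \<subseteq> {..<m}"
      from Forms_outside[OF assms(2) this] show ?thesis by (simp only: qmul_0_right)
    qed
  qed
  then show "(\<mu> \<odot> \<nu>) K = 0" unfolding fmul_apply by (intro sum.neutral) auto
qed

lemma fmul_0_left [simp]: "0 \<odot> \<nu> = 0" and fmul_0_right [simp]: "\<mu> \<odot> 0 = 0"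
  by (rule ext; simp add: fmul_apply)+

lemma fmul_add_left:
  assumes "\<mu> \<in> Forms m" "\<mu>' \<in> Forms m" "\<nu> \<in> Forms m"
  shows "(\<mu> + \<mu>') \<odot> \<nu> = \<mu> \<odot> \<nu> + \<mu>' \<odot> \<nu>"
  by (rule ext) (simp only: fmul_apply plus_fun_apply sum.distrib qscale_add
      qmul_add_left[OF Forms_qtorus[OF assms(1)] Forms_qtorus[OF assms(2)] Forms_qtorus[OF assms(3)]])

lemma fmul_add_right:
  assumes "\<mu> \<in> Forms m" "\<nu> \<in> Forms m" "\<nu>' \<in> Forms m"
  shows "\<mu> \<odot> (\<nu> + \<nu>') = \<mu> \<odot> \<nu> + \<mu> \<odot> \<nu>'"
  by (rule ext) (simp only: fmul_apply plus_fun_apply sum.distrib qscale_add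
      qmul_add_right[OF Forms_qtorus[OF assms(1)] Forms_qtorus[OF assms(2)] Forms_qtorus[OF assms(3)]])

lemma fmul_fscale_left: "fscale c \<mu> \<odot> \<nu> = fscale c (\<mu> \<odot> \<nu>)"
  by (rule ext) (simp add: fmul_apply fscale_eq qmul_qscale qscale_sum mult.commute)

lemma fmul_fscale_right: "\<mu> \<odot> fscale c \<nu> = fscale c (\<mu> \<odot> \<nu>)"
  by (rule ext) (simp add: fmul_apply fscale_eq qmul_qscale qscale_sum mult.commute)

lemma wsign_empty [simp]: "wsign {} J = 1" "wsign I {} = 1"
  by (simp_all add: wsign_def)

lemma wsign_union_left:
  assumes "finite I" "finite I'" "finite J" "I \<inter> I' = {}"
  shows "wsign (I \<union> I') J = wsign I J * wsign I' J"
proof -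
  let ?S = "\<lambda>I. {(i, j). i \<in> I \<and> j \<in> J \<and> j < i}"
  have fin: "finite (?S I)" if "finite I" for I
    by (rule finite_subset[of _ "I \<times> J"]) (use that assms in auto)
  have "?S (I \<union> I') = ?S I \<union> ?S I'" by auto
  then have "card (?S (I \<union> I')) = card (?S I) + card (?S I')"
    by (simp only:) (rule card_Un_disjoint, use assms fin in auto)
  then show ?thesis by (simp add: wsign_def power_add)
qed

lemma wsign_union_right:
  assumes "finite I" "finite J" "finite J'" "J \<inter> J' = {}"
  shows "wsign I (J \<union> J') = wsign I J * wsign I J'"
proof -
  let ?S = "\<lambda>J. {(i, j). i \<in> I \<and> j \<in> J \<and> j < i}"
  have fin: "finite (?S J)" if "finite J" for J
    by (rule finite_subset[of _ "I \<times> J"]) (use that assms in auto)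
  have "?S (J \<union> J') = ?S J \<union> ?S J'" by auto
  then have "card (?S (J \<union> J')) = card (?S J) + card (?S J')"
    by (simp only:) (rule card_Un_disjoint, use assms fin in auto)
  then show ?thesis by (simp add: wsign_def power_add)
qed

text \<open>
  Either side is a sum over the ways of splitting \<open>K\<close> into three disjoint parts \<open>J\<close>, \<open>L\<close>, \<open>M\<close>; on the
  left the splitting is recorded by \<open>J \<union> L\<close> and \<open>J\<close>, on the right by \<open>J\<close> and \<open>L\<close>.  The signs agree
  because the sign is multiplicative in unions in each argument.
\<close>

lemma fmul_assoc:
  assumes "\<mu> \<in> Forms m" "\<nu> \<in> Forms m" "\<rho> \<in> Forms m" "m \<le> Suc n"
  shows "(\<mu> \<odot> \<nu>) \<odot> \<rho> = \<mu> \<odot> (\<nu> \<odot> \<rho>)"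
proof
  fix K
  note q = Forms_qtorus[OF assms(1)] Forms_qtorus[OF assms(2)] Forms_qtorus[OF assms(3)]
  show "((\<mu> \<odot> \<nu>) \<odot> \<rho>) K = (\<mu> \<odot> (\<nu> \<odot> \<rho>)) K"
  proof (cases "finite K")
    case False
    then show ?thesis using assms by (simp add: Forms_infinite[where m = m] Forms_fmul)
  next
    case True
    let ?t = "\<lambda>c J L M. qscale c (qmul (\<mu> J) (qmul (\<nu> L) (\<rho> M)))"
    have "((\<mu> \<odot> \<nu>) \<odot> \<rho>) K = (\<Sum>I\<in>Pow K. \<Sum>J\<in>Pow I. ?t (wsign I (K - I) * wsign J (I - J)) J (I - J) (K - I))"
      unfolding fmul_apply
    proof (intro sum.cong refl)
      fix I assume "I \<in> Pow K"
      show "qscale (wsign I (K - I)) (qmul (\<Sum>J\<in>Pow I. qscale (wsign J (I - J)) (qmul (\<mu> J) (\<nu> (I - J)))) (\<rho> (K - I)))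
        = (\<Sum>J\<in>Pow I. ?t (wsign I (K - I) * wsign J (I - J)) J (I - J) (K - I))"
        by (subst qmul_sum_left[where m = m])
           (use q in \<open>auto intro!: qtorus_qscale qtorus_qmul simp: qmul_qscale qscale_sum qmul_assoc[OF q assms(4)]\<close>)
    qed
    also have "\<dots> = (\<Sum>(I, J)\<in>Sigma (Pow K) Pow. ?t (wsign I (K - I) * wsign J (I - J)) J (I - J) (K - I))"
      using True by (intro sum.Sigma) (auto intro: finite_subset)
    also have "\<dots> = (\<Sum>(J, L)\<in>Sigma (Pow K) (\<lambda>J. Pow (K - J)). ?t (wsign J (K - J) * wsign L (K - J - L)) J L (K - J - L))"
    proof (rule sum.reindex_bij_witness[of _ "\<lambda>(J, L). (J \<union> L, J)" "\<lambda>(I, J). (J, I - J)"], goal_cases)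
      case (5 a)
      obtain I J where a: "a = (I, J)" and IJ: "I \<subseteq> K" "J \<subseteq> I" using 5 by auto
      then have fin: "finite I" "finite J" using True by (auto intro: finite_subset)
      have "wsign I (K - I) * wsign J (I - J) = wsign J (K - I) * wsign (I - J) (K - I) * wsign J (I - J)"
        using wsign_union_left[of J "I - J" "K - I"] IJ fin True by (simp add: Un_absorb1)
      also have "\<dots> = wsign J ((I - J) \<union> (K - I)) * wsign (I - J) (K - I)"
        using IJ fin True by (subst wsign_union_right) auto
      also have "(I - J) \<union> (K - I) = K - J" using IJ by auto
      moreover have "K - J - (I - J) = K - I" using IJ by auto
      ultimately show ?case using a by simp
    qed auto
    also have "\<dots> = (\<Sum>J\<in>Pow K. \<Sum>L\<in>Pow (K - J). ?t (wsign J (K - J) * wsign L (K - J - L)) J L (K - J - L))"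
      using True by (intro sum.Sigma[symmetric]) auto
    also have "\<dots> = (\<mu> \<odot> (\<nu> \<odot> \<rho>)) K"
      unfolding fmul_apply
    proof (intro sum.cong refl)
      fix J assume "J \<in> Pow K"
      show "(\<Sum>L\<in>Pow (K - J). ?t (wsign J (K - J) * wsign L (K - J - L)) J L (K - J - L)) =
        qscale (wsign J (K - J)) (qmul (\<mu> J) (\<Sum>L\<in>Pow (K - J). qscale (wsign L (K - J - L)) (qmul (\<nu> L) (\<rho> (K - J - L)))))"
        by (subst qmul_sum_right[where m = m])
           (use q in \<open>auto intro!: qtorus_qscale qtorus_qmul simp: qmul_qscale qscale_sum\<close>)
    qed
    finally show ?thesis .
  qed
qed

lemma deg0_fmul_apply:
  assumes "finite K" shows "(deg0 a \<odot> \<nu>) K = qmul a (\<nu> K)"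
proof -
  have "(deg0 a \<odot> \<nu>) K = (\<Sum>I\<in>{{}}. qscale (wsign I (K - I)) (qmul (deg0 a I) (\<nu> (K - I))))"
    unfolding fmul_apply using assms by (intro sum.mono_neutral_right) (auto simp: deg0_def)
  then show ?thesis by (simp add: deg0_def)
qed

text \<open>
  Multiplication by an element of degree 0 acts on the coefficients alone.  For infinite \<open>K\<close>, where
  the product of forms is an empty sum, the right-hand side vanishes since the coefficient does.
\<close>

lemma deg0_fmul:
  assumes "\<nu> \<in> Forms m" shows "deg0 a \<odot> \<nu> = (\<lambda>K. qmul a (\<nu> K))"
proof
  fix K show "(deg0 a \<odot> \<nu>) K = qmul a (\<nu> K)"
  proof (cases "finite K")
    case False
    have "(deg0 a \<odot> \<nu>) K = 0" using False by (simp add: fmul_apply)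
    then show ?thesis by (simp only: Forms_infinite[OF assms False] qmul_0_right)
  qed (rule deg0_fmul_apply)
qed

lemma fmul_deg0:
  assumes "\<nu> \<in> Forms m" shows "\<nu> \<odot> deg0 a = (\<lambda>K. qmul (\<nu> K) a)"
proof
  fix K show "(\<nu> \<odot> deg0 a) K = qmul (\<nu> K) a"
  proof (cases "finite K")
    case True
    then have "(\<nu> \<odot> deg0 a) K = (\<Sum>I\<in>{K}. qscale (wsign I (K - I)) (qmul (\<nu> I) (deg0 a (K - I))))"
      unfolding fmul_apply by (intro sum.mono_neutral_right) (auto simp: deg0_def)
    then show ?thesis by (simp add: deg0_def)
  next
    case False
    have "(\<nu> \<odot> deg0 a) K = 0" using False by (simp add: fmul_apply)
    then show ?thesis by (simp only: Forms_infinite[OF assms False] qmul_0_left)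
  qed
qed

lemma deg0_fmul_deg0: "deg0 a \<odot> deg0 b = deg0 (qmul a b)"
proof
  fix K show "(deg0 a \<odot> deg0 b) K = deg0 (qmul a b) K"
  proof (cases "finite K")
    case True
    then show ?thesis by (simp only: deg0_fmul_apply) (simp add: deg0_def)
  next
    case False
    then show ?thesis by (auto simp: fmul_apply) (auto simp: deg0_def)
  qed
qed

lemma fone_fmul: "\<nu> \<in> Forms m \<Longrightarrow> fone \<odot> \<nu> = \<nu>"
  unfolding fone_def by (simp add: deg0_fmul qmul_one_left[OF Forms_qtorus])

lemma fmul_fone: "\<nu> \<in> Forms m \<Longrightarrow> m \<le> Suc n \<Longrightarrow> \<nu> \<odot> fone = \<nu>"
  unfolding fone_def by (simp add: fmul_deg0 qmul_one_right[OF Forms_qtorus])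

lemma Forms_deg_0_iff: "b \<in> Forms_deg m 0 \<longleftrightarrow> (\<exists>a\<in>qtorus m. b = deg0 a)"
proof
  assume b: "b \<in> Forms_deg m 0"
  then have F: "b \<in> Forms m" by (simp add: Forms_deg_def)
  have "b = deg0 (b {})"
  proof
    fix I show "b I = deg0 (b {}) I"
      using b Forms_infinite[OF F, of I] by (cases "finite I") (auto simp: deg0_def Forms_deg_def card_eq_0_iff)
  qed
  with F show "\<exists>a\<in>qtorus m. b = deg0 a" using Forms_qtorus by blast
qed (auto simp: Forms_deg_def, auto simp: deg0_def)


section \<open>The differential, the star operation and the Hodge operator\<close>

lemma qderiv_add: "qderiv j (x + y) = qderiv j x + qderiv j y"
  by (rule ext) (simp add: qderiv_def ring_distribs)

lemma qderiv_qscale: "qderiv j (qscale c x) = qscale c (qderiv j x)"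
  by (rule ext) (simp add: qderiv_def qscale_def)

lemma qderiv_0 [simp]: "qderiv j 0 = 0"
  by (rule ext) (simp add: qderiv_def)

lemma qderiv_commute: "qderiv i (qderiv j x) = qderiv j (qderiv i x)"
  by (rule ext) (simp add: qderiv_def)

lemma qderiv_outside:
  assumes "x \<in> qtorus m" "m \<le> j" shows "qderiv j x = 0"
proof
  fix k show "qderiv j x k = 0 k"
    using assms qtorus_outside[OF assms(1), of k]
    by (cases "k \<in> lattice_pts m") (auto simp: qderiv_def lattice_pts_def)
qed

text \<open>
  The sum over all \<open>j\<close> with \<open>K = {j}\<close> has at most one term.  The restriction \<open>j \<le> n\<close> of the definition
  is absent from it since the other derivations annihilate the quantum torus.
\<close>

lemma dfun_apply:
  assumes "x \<in> qtorus m" "m \<le> Suc n"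
  shows "dfun x K = (\<Sum>j | K = {j}. qscale \<i> (qderiv j x))"
proof -
  have summand: "(deg0 (qderiv j x) \<odot> dU {j}) K = (if K = {j} then qderiv j x else 0)" if "j \<le> n" for j
  proof -
    have "dU {j} \<in> Forms (Suc n)" using that by simp
    then show ?thesis
      using qmul_one_right[OF qtorus_qderiv[OF assms(1)] assms(2)] by (simp only: deg0_fmul) (simp add: dU_def)
  qed
  have "dfun x K = qscale \<i> (\<Sum>j\<le>n. if K = {j} then qderiv j x else 0)"
    by (simp add: dfun_def fscale_eq sum_fun_apply[of "\<lambda>j. deg0 (qderiv j x) \<odot> dU {j}"] summand)
  also have "\<dots> = (\<Sum>j | j \<le> n \<and> K = {j}. qscale \<i> (qderiv j x))"
    by (simp add: qscale_sum sum.inter_filter[symmetric] if_distrib cong: if_cong)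
  also have "\<dots> = (\<Sum>j | K = {j}. qscale \<i> (qderiv j x))"
    by (intro sum.mono_neutral_left) 
       (use assms in \<open>auto simp: qderiv_outside intro: finite_subset[of _ "the_elem ` {K}"]\<close>)
  finally show ?thesis .
qed

lemma dfun_singleton:
  assumes "x \<in> qtorus m" "m \<le> Suc n" shows "dfun x {j} = qscale \<i> (qderiv j x)"
  by (simp add: dfun_apply[OF assms])

lemma dfun_other:
  assumes "x \<in> qtorus m" "m \<le> Suc n" "\<nexists>j. K = {j}" shows "dfun x K = 0"
  using assms(3) by (simp add: dfun_apply[OF assms(1,2)])

text \<open>
  A one-form is supported on singletons, which reduces the sum over subsets in its product with
  another form to a sum over elements.
\<close>

lemma sum_Pow_singletons:
  assumes "finite K" "\<And>I. I \<subseteq> K \<Longrightarrow> \<nexists>j. I = {j} \<Longrightarrow> g I = 0"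
  shows "(\<Sum>I\<in>Pow K. g I) = (\<Sum>j\<in>K. g {j})"
proof -
  have "(\<Sum>I\<in>Pow K. g I) = (\<Sum>I\<in>(\<lambda>j. {j}) ` K. g I)"
    using assms by (intro sum.mono_neutral_right) auto
  also have "\<dots> = (\<Sum>j\<in>K. g {j})" by (subst sum.reindex) auto
  finally show ?thesis .
qed

text \<open>
  The familiar coordinate formula: the coefficient at \<open>K\<close> collects the partial derivatives of the
  coefficients at \<open>K - {j}\<close>, with the sign of moving \<open>e\<^sub>j\<close> into place.
\<close>

lemma fd_apply:
  assumes "\<mu> \<in> Forms m" "m \<le> Suc n"
  shows "fd \<mu> K = (\<Sum>j\<in>K. qscale (\<i> * wsign {j} (K - {j})) (qderiv j (\<mu> (K - {j}))))"
proof (cases "finite K")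
  case False
  then show ?thesis by (simp add: fd_def sum_fun_apply fmul_apply)
next
  case True
  note q = Forms_qtorus[OF assms(1)]
  have d: "dfun (\<mu> I) J \<in> qtorus m" for I J
    unfolding dfun_apply[OF q assms(2)] by (intro qtorus_sum qtorus_qscale qtorus_qderiv q)
  have "fd \<mu> K = (\<Sum>I\<in>Pow {..n}. \<Sum>J\<in>Pow K. if I = K - J then qscale (wsign J (K - J)) (dfun (\<mu> I) J) else 0)"
    unfolding fd_def sum_fun_apply[of "\<lambda>I. dfun (\<mu> I) \<odot> dU I"] fmul_apply
    by (intro sum.cong refl) (auto simp: dU_def qmul_one_right[OF d assms(2)])
  also have "\<dots> = (\<Sum>J\<in>Pow K. \<Sum>I\<in>Pow {..n}. if I = K - J then qscale (wsign J (K - J)) (dfun (\<mu> I) J) else 0)"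
    by (rule sum.swap)
  also have "\<dots> = (\<Sum>J\<in>Pow K. qscale (wsign J (K - J)) (dfun (\<mu> (K - J)) J))"
  proof (intro sum.cong refl)
    fix J
    have "\<mu> (K - J) = 0" if "\<not> K - J \<subseteq> {..n}"
      using that Forms_outside[OF assms(1), of "K - J"] assms(2) by fastforce
    then have "dfun (\<mu> (K - J)) J = 0" if "\<not> K - J \<subseteq> {..n}"
      using that by (simp add: dfun_apply[OF qtorus_0[of 0]])
    then show "(\<Sum>I\<in>Pow {..n}. if I = K - J then qscale (wsign J (K - J)) (dfun (\<mu> I) J) else 0)
        = qscale (wsign J (K - J)) (dfun (\<mu> (K - J)) J)"
      by (auto simp: sum.delta')
  qed
  also have "\<dots> = (\<Sum>j\<in>K. qscale (wsign {j} (K - {j})) (dfun (\<mu> (K - {j})) {j}))"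
    using True by (intro sum_Pow_singletons) (auto simp: dfun_other[OF q assms(2)])
  also have "\<dots> = (\<Sum>j\<in>K. qscale (\<i> * wsign {j} (K - {j})) (qderiv j (\<mu> (K - {j}))))"
    by (simp add: dfun_singleton[OF q assms(2)] mult.commute)
  finally show ?thesis .
qed

lemma Forms_fd:
  assumes "\<mu> \<in> Forms m" "m \<le> Suc n" shows "fd \<mu> \<in> Forms m"
  unfolding Forms_iff
proof (intro conjI allI impI)
  show "fd \<mu> K \<in> qtorus m" for K
    unfolding fd_apply[OF assms] by (intro qtorus_sum qtorus_qscale qtorus_qderiv Forms_qtorus assms)
  fix K :: "nat set" assume K: "\<not> K \<subseteq> {..<m}"
  have "qderiv j (\<mu> (K - {j})) = 0" for j
  proof (cases "j < m")
    case True
    then have "\<not> K - {j} \<subseteq> {..<m}" using K by auto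
    then show ?thesis by (simp only: Forms_outside[OF assms(1) \<open>\<not> K - {j} \<subseteq> {..<m}\<close>] qderiv_0)
  qed (use assms in \<open>simp add: qderiv_outside[OF Forms_qtorus]\<close>)
  then show "fd \<mu> K = 0" by (simp add: fd_apply[OF assms])
qed

lemma fd_add:
  assumes "\<mu> \<in> Forms m" "\<nu> \<in> Forms m" "m \<le> Suc n" shows "fd (\<mu> + \<nu>) = fd \<mu> + fd \<nu>"
  by (rule ext) (simp only: fd_apply[OF Forms_add[OF assms(1,2)] assms(3)] fd_apply[OF assms(1,3)]
      fd_apply[OF assms(2,3)] plus_fun_apply qderiv_add qscale_add sum.distrib)

lemma fd_fscale:
  assumes "\<mu> \<in> Forms m" "m \<le> Suc n" shows "fd (fscale c \<mu>) = fscale c (fd \<mu>)"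
  unfolding fscale_eq
  by (rule ext) (simp add: fd_apply[OF Forms_fscale[OF assms(1), unfolded fscale_eq] assms(2)]
      fd_apply[OF assms] qderiv_qscale qscale_sum mult_ac)

lemma fd_0 [simp]: "fd 0 = 0"
  by (rule ext) (simp add: fd_apply[where m = 0])

lemma fd_deg0_singleton:
  assumes "a \<in> qtorus m" "m \<le> Suc n" shows "fd (deg0 a) {j} = qscale \<i> (qderiv j a)"
  using assms by (simp add: fd_apply[where m = m]) (simp add: deg0_def)

lemma fd_deg0_other:
  assumes "a \<in> qtorus m" "m \<le> Suc n" "\<nexists>j. K = {j}" shows "fd (deg0 a) K = 0"
proof -
  have "deg0 a (K - {j}) = 0" if "j \<in> K" for j
    using that assms(3) by (auto simp: deg0_def)
  then show ?thesis using assms by (subst fd_apply[where m = m]) auto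
qed

lemma fd_deg0_degree:
  assumes "a \<in> qtorus m" "m \<le> Suc n" shows "fd (deg0 a) \<in> Forms_deg m 1"
  using assms Forms_fd[of "deg0 a" m] fd_deg0_other[OF assms]
  by (auto simp: Forms_deg_def card_1_singleton_iff)

text \<open>
  The graded Leibniz rule with a left factor of degree 0, which is all that elements of the
  associated bundle require.  In the coordinate formula it is the Leibniz rule of each derivation.
\<close>

lemma fd_deg0_fmul:
  assumes "a \<in> qtorus m" "\<nu> \<in> Forms m" "m \<le> Suc n"
  shows "fd (deg0 a \<odot> \<nu>) = fd (deg0 a) \<odot> \<nu> + deg0 a \<odot> fd \<nu>"
proof
  fix K
  have a: "deg0 a \<in> Forms m" using assms by simp
  note q = Forms_qtorus[OF assms(2)]
  show "fd (deg0 a \<odot> \<nu>) K = (fd (deg0 a) \<odot> \<nu> + deg0 a \<odot> fd \<nu>) K"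
  proof (cases "finite K")
    case False
    have F: "fd (deg0 a \<odot> \<nu>) \<in> Forms m" "fd (deg0 a) \<odot> \<nu> + deg0 a \<odot> fd \<nu> \<in> Forms m"
      using assms a by (auto intro!: Forms_fd Forms_fmul)
    show ?thesis by (simp only: Forms_infinite[OF F(1) False] Forms_infinite[OF F(2) False])
  next
    case True
    let ?w = "\<lambda>j. \<i> * wsign {j} (K - {j})"
    have 1: "(fd (deg0 a) \<odot> \<nu>) K = (\<Sum>j\<in>K. qscale (?w j) (qmul (qderiv j a) (\<nu> (K - {j}))))"
      unfolding fmul_apply using True
      by (subst sum_Pow_singletons)
         (auto simp: fd_deg0_other[OF assms(1,3)] fd_deg0_singleton[OF assms(1,3)] qmul_qscale mult.commute)
    have 2: "(deg0 a \<odot> fd \<nu>) K = (\<Sum>j\<in>K. qscale (?w j) (qmul a (qderiv j (\<nu> (K - {j})))))"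
      using True assms(1)
      by (simp add: deg0_fmul_apply fd_apply[OF assms(2,3)])
         (subst qmul_sum_right[where m = m]; auto simp: qmul_qscale intro!: q)
    have "fd (deg0 a \<odot> \<nu>) K = (\<Sum>j\<in>K. qscale (?w j) (qderiv j (qmul a (\<nu> (K - {j})))))"
      by (subst fd_apply[OF Forms_fmul[OF a assms(2)] assms(3)]) (simp add: deg0_fmul[OF assms(2)])
    also have "\<dots> = (fd (deg0 a) \<odot> \<nu>) K + (deg0 a \<odot> fd \<nu>) K"
      unfolding 1 2 by (simp only: qderiv_qmul[OF assms(1) q] qscale_add sum.distrib)
    finally show ?thesis by simp
  qed
qed

text \<open>
  This is where the vanishing of the curvature comes from: at \<open>{j, l}\<close> the two mixed second
  derivatives occur with opposite signs, and the derivations commute.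
\<close>

lemma fd_fd_deg0:
  assumes "a \<in> qtorus m" "m \<le> Suc n" shows "fd (fd (deg0 a)) = 0"
proof
  fix K
  let ?t = "\<lambda>j. qscale (\<i> * wsign {j} (K - {j})) (qderiv j (fd (deg0 a) (K - {j})))"
  have eq: "fd (fd (deg0 a)) K = (\<Sum>j\<in>K. ?t j)"
    using assms by (intro fd_apply Forms_fd) auto
  show "fd (fd (deg0 a)) K = 0 K"
  proof (cases "\<exists>j l. j < l \<and> K = {j, l}")
    case True
    then obtain j l where jl: "j < l" and K: "K = {j, l}" by blast
    then have diff: "K - {j} = {l}" "K - {l} = {j}" by auto
    have "{(i, i'). i \<in> {j} \<and> i' \<in> {l} \<and> i' < i} = {}" "{(i, i'). i \<in> {l} \<and> i' \<in> {j} \<and> i' < i} = {(l, j)}"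
      using jl by auto
    then have "wsign {j} {l} = 1" "wsign {l} {j} = - 1"
      unfolding wsign_def by (simp_all only: card.empty) simp_all
    then have "fd (fd (deg0 a)) K = qscale (- 1) (qderiv j (qderiv l a)) + qscale 1 (qderiv l (qderiv j a))"
      unfolding eq unfolding K using jl by (simp add: diff[unfolded K] fd_deg0_singleton[OF assms] qderiv_qscale)
    then show ?thesis by (simp only: qderiv_commute[of j l]) (simp add: qscale_def fun_eq_iff)
  next
    case False
    have "fd (deg0 a) (K - {j}) = 0" if "j \<in> K" for j
    proof (rule fd_deg0_other[OF assms])
      show "\<nexists>l. K - {j} = {l}"
      proof
        assume "\<exists>l. K - {j} = {l}"
        then obtain l where l: "K - {j} = {l}" ..
        then have "l \<in> K - {j}" by simp
        then have "l < j \<or> j < l" by auto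
        moreover have "K = {j, l}" "K = {l, j}" using l that by auto
        ultimately show False using False by blast
      qed
    qed
    then show ?thesis by (simp add: eq)
  qed
qed

lemma Forms_fstar [intro]: "\<mu> \<in> Forms m \<Longrightarrow> fstar \<mu> \<in> Forms m"
  by (auto simp: Forms_iff fstar_def)

lemma fstar_deg0: "fstar (deg0 a) = deg0 (qstar a)"
  by (rule ext) (simp add: fstar_def deg0_def)

lemma fstar_add: "fstar (\<mu> + \<nu>) = fstar \<mu> + fstar \<nu>"
  by (rule ext) (simp only: fstar_def plus_fun_apply qstar_add)

lemma fstar_0 [simp]: "fstar 0 = 0"
  by (rule ext) (simp add: fstar_def)

text \<open>
  The star operation does not reverse wedge products, but a factor of degree 0 still changes sides.
\<close>

lemma fstar_deg0_fmul:
  assumes "a \<in> qtorus m" "\<mu> \<in> Forms m" "m \<le> Suc n"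
  shows "fstar (deg0 a \<odot> \<mu>) = fstar \<mu> \<odot> fstar (deg0 a)"
  unfolding fstar_deg0 fmul_deg0[OF Forms_fstar[OF assms(2)]] deg0_fmul[OF assms(2)]
  by (simp add: fstar_def qstar_qmul[OF assms(1) Forms_qtorus[OF assms(2)] assms(3)])

text \<open>
  The derivations commute with the star operation, so the sign is that of the conjugate of the factor
  \<open>\<i>\<close> in the differential.
\<close>

lemma fd_fstar_deg0:
  assumes "a \<in> qtorus m" "m \<le> Suc n"
  shows "fd (fstar (deg0 a)) = - fstar (fd (deg0 a))"
proof
  fix K
  note s = qtorus_qstar[OF assms(1)]
  show "fd (fstar (deg0 a)) K = (- fstar (fd (deg0 a))) K"
  proof (cases "\<exists>j. K = {j}")
    case True
    then obtain j where K: "K = {j}" by blast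
    have "fd (fstar (deg0 a)) K = qscale \<i> (qstar (qderiv j a))"
      unfolding K fstar_deg0 fd_deg0_singleton[OF s assms(2)] qderiv_qstar ..
    moreover have "fstar (fd (deg0 a)) K = qscale (- \<i>) (qstar (qderiv j a))"
      unfolding K fstar_def fd_deg0_singleton[OF assms] by (simp add: qscale_def qstar_scale)
    ultimately show ?thesis by (simp add: qscale_def fun_eq_iff)
  next
    case False
    then show ?thesis
      by (simp add: fstar_deg0 fd_deg0_other[OF s assms(2)]) (simp add: fstar_def fd_deg0_other[OF assms])
  qed
qed

lemma Forms_hodge:
  assumes "\<mu> \<in> Forms n" shows "hodge \<mu> \<in> Forms n"
proof -
  have "hodge \<mu> K \<in> qtorus n" for K
    unfolding hodge_def using qtorus_scale[OF Forms_qtorus[OF assms]] by simp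
  moreover have "hodge \<mu> K = 0" if "\<not> K \<subseteq> {..<n}" for K
    using that by (simp only: hodge_def if_False)
  ultimately show ?thesis unfolding Forms_iff by blast
qed

lemma hodge_add: "hodge (\<mu> + \<nu>) = hodge \<mu> + hodge \<nu>"
  by (intro ext) (simp add: hodge_def ring_distribs)

lemma hodge_deg0_fmul:
  assumes "\<mu> \<in> Forms n" shows "hodge (deg0 a \<odot> \<mu>) = deg0 a \<odot> hodge \<mu>"
  unfolding deg0_fmul[OF assms] deg0_fmul[OF Forms_hodge[OF assms]]
  by (intro ext) (simp add: hodge_def qmul_scale_right)

section \<open>The associated bundle and its tensor products\<close>

text \<open>
  Morphisms and forms are handled as elements of modules from here on.  Evaluating their sums
  pointwise would expand them to abstractions, to which the module laws do not apply.
\<close>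

declare plus_fun_apply [simp del] zero_fun_apply [simp del] minus_apply [simp del] uminus_apply [simp del]

lemmas fun_apply_simps = plus_fun_apply zero_fun_apply minus_apply uminus_apply

text \<open>
  A linear map on the line spanned by \<open>\<vartheta>\<close> is determined by its value at \<open>\<vartheta>\<close>, which is \<open>1\<close> in the
  chosen coordinates.  The image of \<open>fone\<close> is the generator of \<open>E\<close> as a right module.
\<close>

definition frame :: "qform \<Rightarrow> emor" where
  "frame \<mu> = (\<lambda>\<theta>. fscale \<theta> \<mu>)"

lemma fscale_minus_1: "fscale (- 1) \<mu> = - \<mu>"
  by (simp add: fscale_def fun_eq_iff fun_apply_simps)

lemma fscale_0 [simp]: "fscale c 0 = 0"
  by (simp add: fscale_def fun_eq_iff fun_apply_simps)

lemma frame_1 [simp]: "frame \<mu> 1 = \<mu>"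
  by (simp add: frame_def fscale_def)

lemma frame_add: "frame (\<mu> + \<nu>) = frame \<mu> + frame \<nu>"
  by (simp add: frame_def fscale_def fun_eq_iff fun_apply_simps ring_distribs)

lemma frame_0 [simp]: "frame 0 = 0"
  by (simp add: frame_def fscale_def fun_eq_iff fun_apply_simps)

lemma frame_linear: "Vector_Spaces.linear (*) fscale (frame \<mu>)"
  unfolding frame_def by (unfold_locales) (auto simp: fscale_def fun_eq_iff fun_apply_simps algebra_simps)

lemma linear_eq_frame:
  assumes "Vector_Spaces.linear (*) fscale T" shows "T = frame (T 1)"
proof
  fix \<theta>
  interpret Vector_Spaces.linear "(*)" fscale T by fact
  show "T \<theta> = frame (T 1) \<theta>" using scale[of \<theta> 1] by (simp add: frame_def)
qed

lemma rmul_apply: "rmul T \<mu> \<theta> = T \<theta> \<odot> \<mu>"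
  by (simp add: rmul_def)

lemma rmul_frame: "rmul (frame \<mu>) \<nu> = frame (\<mu> \<odot> \<nu>)"
  by (simp add: rmul_def frame_def fmul_fscale_left)

text \<open>
  Base forms are coinvariant: they contain neither powers of the fibre generator nor \<open>dU {n}\<close>.
\<close>

lemma coaction_base:
  assumes "\<mu> \<in> Forms n"
  shows "coaction \<mu> = (\<lambda>j \<epsilon>. if j = 0 \<and> \<epsilon> = 0 then \<mu> else 0)"
proof (intro ext)
  fix j :: int and \<epsilon> I k
  have "\<mu> (insert n I) = 0" using assms by (auto intro: Forms_outside)
  moreover have "\<mu> I k = 0" if "k n \<noteq> 0"
    using that Forms_qtorus[OF assms, of I] by (auto intro!: qtorus_outside simp: lattice_pts_def)
  ultimately show "coaction \<mu> j \<epsilon> I k = (if j = 0 \<and> \<epsilon> = 0 then \<mu> else 0) I k"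
    by (auto simp: coaction_def fun_apply_simps)
qed

lemma frame_base_in_Mor_ad:
  assumes "\<mu> \<in> Forms n" "\<And>c. fscale c \<mu> \<in> W" shows "frame \<mu> \<in> Mor_ad W"
  unfolding Mor_ad_def
proof (intro CollectI conjI allI frame_linear)
  show "range (frame \<mu>) \<subseteq> W" using assms(2) by (auto simp: frame_def)
  show "tensor_id (frame \<mu>) (ad_corep \<theta>) = coaction (frame \<mu> \<theta>)" for \<theta>
    using coaction_base[OF Forms_fscale[OF assms(1), of \<theta>]]
    by (auto simp: frame_def tensor_id_def ad_corep_def fscale_def fun_eq_iff fun_apply_simps)
qed

lemma E_frame:
  assumes "a \<in> qtorus n" shows "frame (deg0 a) \<in> E"
proof (rule frame_base_in_Mor_ad)
  show "fscale c (deg0 a) \<in> P" for c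
    using assms by (auto simp: Forms_deg_0_iff deg0_def fscale_eq fun_eq_iff fun_apply_simps
        intro!: bexI[of _ "qscale c a"] qtorus_qscale qtorus_mono[of _ n])
qed (use assms in simp)

text \<open>
  As \<open>ad\<close> is trivial, the value at \<open>\<vartheta>\<close> has to be coinvariant, hence an element of the base.  Together
  with \<open>E_frame\<close> this makes \<open>E\<close> a free module of rank one over the base.
\<close>

lemma E_cases:
  assumes "T \<in> E" obtains a where "a \<in> qtorus n" "T = frame (deg0 a)"
proof -
  have lin: "Vector_Spaces.linear (*) fscale T" and P: "T 1 \<in> P"
    and coact: "tensor_id T (ad_corep 1) = coaction (T 1)"
    using assms by (auto simp: Mor_ad_def)
  obtain a where a: "a \<in> qtorus (Suc n)" "T 1 = deg0 a" using P by (auto simp: Forms_deg_0_iff)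
  have T0: "T 0 = 0" by (subst linear_eq_frame[OF lin]) (simp add: frame_def fscale_def fun_eq_iff fun_apply_simps)
  have "a k = 0" if "k n \<noteq> 0" for k
  proof -
    have "a k = coaction (T 1) (k n) 0 {} k" by (simp add: coaction_def a deg0_def)
    also have "\<dots> = 0" using that by (simp add: coact[symmetric] tensor_id_def ad_corep_def T0 fun_apply_simps)
    finally show ?thesis .
  qed
  then have "a \<in> qtorus n" by (rule qtorus_restrict[OF a(1)])
  then show thesis using that[of a] linear_eq_frame[OF lin] a(2) by simp
qed

lemma E_coord:
  assumes "T \<in> E" shows "T 1 \<in> B" "T 1 \<in> Forms n" "T = frame (T 1)"
  using assms by (auto elim!: E_cases simp: Forms_deg_0_iff)

lemma E_coord_deg0:
  assumes "T \<in> E" obtains a where "a \<in> qtorus n" "T 1 = deg0 a"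
  using E_coord(1)[OF assms] by (auto simp: Forms_deg_0_iff)

lemma E_add: "T \<in> E \<Longrightarrow> T' \<in> E \<Longrightarrow> T + T' \<in> E"
proof (elim E_cases)
  fix a b assume "a \<in> qtorus n" "b \<in> qtorus n" "T = frame (deg0 a)" "T' = frame (deg0 b)"
  moreover have "deg0 a + deg0 b = deg0 (a + b)" by (auto simp: deg0_def fun_eq_iff fun_apply_simps)
  ultimately show "T + T' \<in> E" by (simp add: E_frame qtorus_add flip: frame_add)
qed

lemma E_0 [simp]: "0 \<in> E"
  using E_frame[of 0] by (simp add: deg0_def flip: zero_fun_def)

lemma E_fscale: "T \<in> E \<Longrightarrow> (\<lambda>\<theta>. fscale c (T \<theta>)) \<in> E"
proof (elim E_cases)
  fix a assume "a \<in> qtorus n" "T = frame (deg0 a)"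
  moreover have "(\<lambda>\<theta>. fscale c (frame (deg0 a) \<theta>)) = frame (deg0 (qscale c a))"
    by (auto simp: frame_def fscale_def deg0_def qscale_def fun_eq_iff fun_apply_simps)
  ultimately show "(\<lambda>\<theta>. fscale c (T \<theta>)) \<in> E" by (simp add: E_frame qtorus_qscale)
qed

lemma E_rmul:
  assumes "T \<in> E" "b \<in> B" shows "rmul T b \<in> E"
  using assms by (auto elim!: E_cases
      simp: Forms_deg_0_iff rmul_frame deg0_fmul_deg0 intro!: E_frame qtorus_qmul)

lemma base_assoc:
  "\<mu> \<in> Forms n \<Longrightarrow> \<nu> \<in> Forms n \<Longrightarrow> \<rho> \<in> Forms n \<Longrightarrow> (\<mu> \<odot> \<nu>) \<odot> \<rho> = \<mu> \<odot> (\<nu> \<odot> \<rho>)"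
  by (rule fmul_assoc[where m = n]) auto

lemma fone_Forms [simp]: "fone \<in> Forms n"
  by (simp add: fone_def)

lemma E_unit: "frame fone \<in> E"
  unfolding fone_def by (intro E_frame) simp

text \<open>
  The coordinate of a formal sum with respect to the generator of \<open>E\<close>.  It is the evaluation
  \<open>T \<otimes> \<mu> \<mapsto> T(\<vartheta>) \<mu>\<close>, and turns out to be a complete invariant of the congruence.
\<close>

definition coord :: "fsum \<Rightarrow> qform" where
  "coord M = (\<Sum>(T, \<mu>)\<in>#M. T 1 \<odot> \<mu>)"

abbreviation well_formed :: "fsum \<Rightarrow> bool" where
  "well_formed M \<equiv> set_mset M \<subseteq> E \<times> Forms n"

text \<open>
  The isomorphism from the base forms onto the tensor product, inverse to the coordinate.
\<close>

definition tens_of :: "qform \<Rightarrow> tens" where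
  "tens_of \<mu> = pure (frame fone) \<mu>"

lemma coord_simps [simp]: "coord {#} = 0" "coord (add_mset (T, \<mu>) M) = T 1 \<odot> \<mu> + coord M"
  "coord (M + N) = coord M + coord N"
  by (simp_all add: coord_def)

lemma coord_Forms: "well_formed M \<Longrightarrow> coord M \<in> Forms n"
proof (induction M)
  case (add p M)
  obtain T \<mu> where p: "p = (T, \<mu>)" by force
  with add have "T 1 \<odot> \<mu> \<in> Forms n" "coord M \<in> Forms n"
    by (auto intro: Forms_fmul E_coord(2))
  then show ?case unfolding p coord_simps by (rule Forms_add)
qed simp

text \<open>
  Each generator of the congruence respects the coordinate: additivity in either argument is
  distributivity of the product of forms, and balancedness is its associativity.
\<close>

lemma teq_invariant:
  assumes "teq M N" shows "well_formed M \<and> well_formed N \<and> coord M = coord N"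
  using assms
proof induction
  case (teq_add_left T T' \<mu>)
  have "(T + T') 1 \<odot> \<mu> = T 1 \<odot> \<mu> + T' 1 \<odot> \<mu>"
    unfolding plus_fun_apply[of T T'] by (intro fmul_add_left[where m = n] E_coord(2) teq_add_left)
  then have "coord {#(T + T', \<mu>)#} = coord {#(T, \<mu>), (T', \<mu>)#}"
    by (simp only: coord_simps add_0_right)
  moreover have "T + T' \<in> E" by (intro E_add teq_add_left)
  ultimately show ?case using teq_add_left by simp
next
  case (teq_add_right T \<mu> \<mu>')
  have "T 1 \<odot> (\<mu> + \<mu>') = T 1 \<odot> \<mu> + T 1 \<odot> \<mu>'"
    by (intro fmul_add_right[where m = n] E_coord(2) teq_add_right)
  then have "coord {#(T, \<mu> + \<mu>')#} = coord {#(T, \<mu>), (T, \<mu>')#}"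
    by (simp only: coord_simps add_0_right)
  then show ?case using teq_add_right Forms_add by simp
next
  case (teq_balanced T b \<mu>)
  then have "b \<in> Forms n" by (simp add: Forms_deg_def)
  with teq_balanced show ?case
    by (simp add: E_rmul Forms_fmul rmul_apply base_assoc E_coord(2))
qed (auto simp: zero_fun_apply[of "1 :: complex"])

lemma teq_add_both:
  assumes "teq M N" "teq M' N'" shows "teq (M + M') (N + N')"
proof -
  have "teq (M + M') (N + M')" using assms teq_invariant by (intro teq_add) auto
  moreover have "teq (M' + N) (N' + N)" using assms teq_invariant by (intro teq_add) auto
  ultimately show ?thesis unfolding add.commute[of M' N] add.commute[of N' N] by (rule teq_trans)
qed

text \<open>
  A summand \<open>T \<otimes> \<mu>\<close> equals \<open>1 \<otimes> T(\<vartheta>) \<mu>\<close> by balancedness, and such summands add up on the right.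
\<close>

lemma teq_unit:
  assumes "well_formed M" shows "teq M {#(frame fone, coord M)#}"
  using assms
proof (induction M)
  case empty
  show ?case using teq_sym[OF teq_zero_right[OF E_unit]] by simp
next
  case (add p M)
  obtain T \<mu> where p: "p = (T, \<mu>)" by force
  with add have T: "T \<in> E" and \<mu>: "\<mu> \<in> Forms n" and M: "well_formed M" by auto
  have "T = rmul (frame fone) (T 1)"
    using E_coord[OF T] by (simp add: rmul_frame fone_fmul)
  then have "teq {#(T, \<mu>)#} {#(frame fone, T 1 \<odot> \<mu>)#}"
    using teq_balanced[OF E_unit E_coord(1)[OF T] \<mu>] by simp
  from teq_add_both[OF this add.IH[OF M]]
  have "teq (add_mset (T, \<mu>) M) {#(frame fone, T 1 \<odot> \<mu>), (frame fone, coord M)#}"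
    by (simp add: add_mset_commute)
  moreover have "teq {#(frame fone, T 1 \<odot> \<mu>), (frame fone, coord M)#} {#(frame fone, T 1 \<odot> \<mu> + coord M)#}"
    by (intro teq_sym[OF teq_add_right] E_unit Forms_fmul E_coord T \<mu> coord_Forms M)
  ultimately show ?case unfolding p coord_simps by (rule teq_trans)
qed

lemma tcls_eq: "teq M N \<Longrightarrow> tcls M = tcls N"
  unfolding tcls_def using teq_sym teq_trans by blast

lemma tcls_tens_of: "well_formed M \<Longrightarrow> tcls M = tens_of (coord M)"
  unfolding tens_of_def pure_def by (intro tcls_eq teq_unit)

lemma trep_tcls: "well_formed M \<Longrightarrow> teq M (trep (tcls M))"
  unfolding trep_def tcls_def using someI[of "\<lambda>N. N \<in> {N. teq M N}" M] teq_refl by auto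

lemma trep_tens_of:
  assumes "\<mu> \<in> Forms n"
  shows "well_formed (trep (tens_of \<mu>))" "coord (trep (tens_of \<mu>)) = \<mu>"
proof -
  have "teq {#(frame fone, \<mu>)#} (trep (tens_of \<mu>))"
    unfolding tens_of_def pure_def using assms E_unit by (intro trep_tcls) auto
  from teq_invariant[OF this] show "well_formed (trep (tens_of \<mu>))" "coord (trep (tens_of \<mu>)) = \<mu>"
    using assms by (auto simp: fone_fmul)
qed

lemma pure_eq_tens_of: "T \<in> E \<Longrightarrow> \<mu> \<in> Forms n \<Longrightarrow> pure T \<mu> = tens_of (T 1 \<odot> \<mu>)"
  unfolding pure_def by (subst tcls_tens_of) auto

lemma tzero_eq_tens_of: "tzero = tens_of 0"
  unfolding tzero_def by (subst tcls_tens_of) auto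

lemma tadd_tens_of:
  assumes "\<mu> \<in> Forms n" "\<nu> \<in> Forms n" shows "tens_of \<mu> \<boxplus> tens_of \<nu> = tens_of (\<mu> + \<nu>)"
  unfolding tadd_def using trep_tens_of[OF assms(1)] trep_tens_of[OF assms(2)] by (subst tcls_tens_of) auto

lemma Tens_eq_tens_of: "Tens = tens_of ` Forms n"
proof
  show "Tens \<subseteq> tens_of ` Forms n"
    by (auto simp: Tens_def tcls_tens_of intro!: imageI coord_Forms)
  show "tens_of ` Forms n \<subseteq> Tens"
  proof
    fix X assume "X \<in> tens_of ` Forms n"
    then obtain \<mu> where "\<mu> \<in> Forms n" "X = tcls {#(frame fone, \<mu>)#}" by (auto simp: tens_of_def pure_def)
    then show "X \<in> Tens" using E_unit unfolding Tens_def by auto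
  qed
qed

text \<open>
  In coordinates, additive extension along the tensor product is application of \<open>h\<close>.  Additivity of \<open>h\<close>
  is what removes the dependence on the arbitrary representative.
\<close>

lemma tlift_tens_of:
  assumes \<mu>: "\<mu> \<in> Forms n"
    and f: "\<And>T \<nu>. T \<in> E \<Longrightarrow> \<nu> \<in> Forms n \<Longrightarrow> f (T, \<nu>) = tens_of (h (T 1 \<odot> \<nu>))"
    and h: "\<And>\<nu>. \<nu> \<in> Forms n \<Longrightarrow> h \<nu> \<in> Forms n"
    and add: "\<And>\<nu> \<rho>. \<nu> \<in> Forms n \<Longrightarrow> \<rho> \<in> Forms n \<Longrightarrow> h (\<nu> + \<rho>) = h \<nu> + h \<rho>"
  shows "tlift f (tens_of \<mu>) = tens_of (h \<mu>)"
proof -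
  have h0: "h 0 = 0" using add[of 0 0] by simp
  have *: "well_formed (\<Sum>p\<in>#M. trep (f p)) \<and> coord (\<Sum>p\<in>#M. trep (f p)) = h (coord M)"
    if "well_formed M" for M
    using that
  proof (induction M)
    case (add p M)
    obtain T \<nu> where p: "p = (T, \<nu>)" by force
    with add have T: "T \<in> E" and \<nu>: "\<nu> \<in> Forms n" and M: "well_formed M" by auto
    have T\<nu>: "T 1 \<odot> \<nu> \<in> Forms n" by (intro Forms_fmul E_coord T \<nu>)
    show ?case
      using add.IH[OF M] trep_tens_of[OF h[OF T\<nu>]] assms(4)[OF T\<nu> coord_Forms[OF M]] f[OF T \<nu>] p by simp
  qed (simp add: h0)
  show ?thesis
    unfolding tlift_def using *[OF trep_tens_of(1)[OF \<mu>]] trep_tens_of(2)[OF \<mu>] by (subst tcls_tens_of) auto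
qed

lemma tscale_tens_of:
  assumes "\<mu> \<in> Forms n" shows "tscale c (tens_of \<mu>) = tens_of (fscale c \<mu>)"
  unfolding tscale_def
proof (rule tlift_tens_of[OF assms])
  fix T \<nu> assume "T \<in> E" "\<nu> \<in> Forms n"
  then show "(case (T, \<nu>) of (T, \<mu>) \<Rightarrow> pure T (fscale c \<mu>)) = tens_of (fscale c (T 1 \<odot> \<nu>))"
    by (simp add: pure_eq_tens_of Forms_fscale fmul_fscale_right)
qed (auto intro: Forms_fscale, auto simp: fscale_def fun_eq_iff fun_apply_simps ring_distribs)

lemma tmul_tens_of:
  assumes "\<mu> \<in> Forms n" "\<nu> \<in> Forms n" shows "tmul (tens_of \<mu>) \<nu> = tens_of (\<mu> \<odot> \<nu>)"
  unfolding tmul_def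
proof (rule tlift_tens_of[OF assms(1)])
  fix T \<rho> assume "T \<in> E" "\<rho> \<in> Forms n"
  then show "(case (T, \<rho>) of (T, \<mu>) \<Rightarrow> pure T (\<mu> \<odot> \<nu>)) = tens_of (T 1 \<odot> \<rho> \<odot> \<nu>)"
    using assms(2) by (simp add: pure_eq_tens_of Forms_fmul base_assoc E_coord)
qed (auto intro!: Forms_fmul fmul_add_left[where m = n] assms)

text \<open>
  The Hodge operator is left linear over the base, as it permutes coefficients up to sign.
\<close>

lemma id_hodge_tens_of:
  assumes "\<mu> \<in> Forms n" shows "id_hodge (tens_of \<mu>) = tens_of (hodge \<mu>)"
  unfolding id_hodge_def
proof (rule tlift_tens_of[OF assms])
  fix T \<nu> assume T: "T \<in> E" and \<nu>: "\<nu> \<in> Forms n"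
  obtain a where "T 1 = deg0 a" using T by (rule E_coord_deg0)
  then show "(case (T, \<nu>) of (T, \<mu>) \<Rightarrow> pure T (hodge \<mu>)) = tens_of (hodge (T 1 \<odot> \<nu>))"
    using T \<nu> by (simp add: pure_eq_tens_of Forms_hodge hodge_deg0_fmul)
qed (auto intro: Forms_hodge hodge_add)

lemma teval_tens_of:
  assumes "\<mu> \<in> Forms n" shows "teval (tens_of \<mu>) = frame \<mu>"
proof -
  have "(\<Sum>(T, \<mu>)\<in>#M. rmul T \<mu>) = frame (coord M)" if "well_formed M" for M
    using that
  proof (induction M)
    case (add p M)
    obtain T \<nu> where p: "p = (T, \<nu>)" by force
    with add have "T \<in> E" by auto
    then have "rmul T \<nu> = frame (T 1 \<odot> \<nu>)" using E_coord(3) by (metis rmul_frame)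
    then show ?case using add p by (simp add: frame_add)
  qed simp
  with trep_tens_of[OF assms] show ?thesis by (simp add: teval_def)
qed

text \<open>
  In coordinates evaluation is \<open>frame\<close>, which is injective; so the choice of a preimage is forced.
\<close>

lemma Upsilon_frame:
  assumes "\<mu> \<in> Forms n" shows "Upsilon (frame \<mu>) = tens_of \<mu>"
proof -
  have Hor: "\<nu> \<in> Hor" if "\<nu> \<in> Forms n" for \<nu>
  proof -
    \<comment> \<open>A horizontal form is a finite sum of products; here one product suffices.\<close>
    have "\<nu> = (\<Sum>i<1::nat. fone \<odot> \<nu>)" using that by (simp add: fone_fmul)
    moreover have "fone \<in> P" unfolding fone_def Forms_deg_0_iff by (rule bexI[of _ "qmonom 0"]) auto
    ultimately show ?thesis unfolding Hor_def using that
      by (intro CollectI exI[of _ "1::nat"] exI[of _ "\<lambda>_. fone"] exI[of _ "\<lambda>_. \<nu>"]) auto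
  qed
  then have mem: "frame \<mu> \<in> Mor_ad Hor"
    using assms by (intro frame_base_in_Mor_ad) auto
  have "inj_on teval Tens"
  proof (rule inj_onI)
    fix X Y assume XY: "X \<in> Tens" "Y \<in> Tens" "teval X = teval Y"
    obtain \<rho> where \<rho>: "X = tens_of \<rho>" "\<rho> \<in> Forms n"
      using XY(1) unfolding Tens_eq_tens_of by (rule imageE)
    obtain \<sigma> where \<sigma>: "Y = tens_of \<sigma>" "\<sigma> \<in> Forms n"
      using XY(2) unfolding Tens_eq_tens_of by (rule imageE)
    have "frame \<rho> 1 = frame \<sigma> 1" using XY(3) \<rho> \<sigma> by (simp only: teval_tens_of)
    then show "X = Y" using \<rho> \<sigma> by simp
  qed
  then have "inv_into Tens teval (teval (tens_of \<mu>)) = tens_of \<mu>"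
    using assms by (intro inv_into_f_f) (auto simp: Tens_eq_tens_of)
  then show ?thesis using mem assms by (simp add: Upsilon_def teval_tens_of)
qed

text \<open>
  On pure tensors this is \<open>\<mu>\<^sub>1\<^sup>* (T\<^sub>1\<^sup>* T\<^sub>2) \<mu>\<^sub>2 = (T\<^sub>1 \<mu>\<^sub>1)\<^sup>* (T\<^sub>2 \<mu>\<^sub>2)\<close>; both sides are biadditive, so it carries over
  to the chosen representatives.
\<close>

lemma tmetric_tens_of:
  assumes "\<mu> \<in> Forms n" "\<nu> \<in> Forms n"
  shows "tmetric (tens_of \<mu>) (tens_of \<nu>) = fstar \<mu> \<odot> \<nu>"
proof -
  have summand: "fstar \<mu>1 \<odot> metric T1 T2 \<odot> \<mu>2 = fstar (T1 1 \<odot> \<mu>1) \<odot> (T2 1 \<odot> \<mu>2)"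
    if "T1 \<in> E" "T2 \<in> E" "\<mu>1 \<in> Forms n" "\<mu>2 \<in> Forms n" for T1 T2 \<mu>1 \<mu>2
  proof -
    obtain a where "a \<in> qtorus n" "T1 1 = deg0 a" using \<open>T1 \<in> E\<close> by (rule E_coord_deg0)
    then have "fstar (T1 1 \<odot> \<mu>1) = fstar \<mu>1 \<odot> fstar (T1 1)"
      using fstar_deg0_fmul[of a n \<mu>1] that by simp
    then show ?thesis
      using that E_coord(2) by (simp add: metric_def base_assoc Forms_fmul Forms_fstar)
  qed
  have inner: "(\<Sum>(T2, \<mu>2)\<in>#N. fstar \<mu>1 \<odot> metric T1 T2 \<odot> \<mu>2) = fstar (T1 1 \<odot> \<mu>1) \<odot> coord N"
    if "well_formed N" "T1 \<in> E" "\<mu>1 \<in> Forms n" for N T1 \<mu>1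
    using that
  proof (induction N)
    case (add p N)
    obtain T \<rho> where p: "p = (T, \<rho>)" by force
    with add have T: "T \<in> E" and \<rho>: "\<rho> \<in> Forms n" and N: "well_formed N" by auto
    have "fstar (T1 1 \<odot> \<mu>1) \<in> Forms n" "T 1 \<odot> \<rho> \<in> Forms n"
      using add.prems T \<rho> by (simp_all add: Forms_fstar Forms_fmul E_coord(2))
    from fmul_add_right[OF this coord_Forms[OF N]] show ?case
      using add.IH[OF N] add.prems p summand[OF add.prems(2) T add.prems(3) \<rho>] by simp
  qed simp
  have outer: "(\<Sum>(T1, \<mu>1)\<in>#M. \<Sum>(T2, \<mu>2)\<in>#N. fstar \<mu>1 \<odot> metric T1 T2 \<odot> \<mu>2) = fstar (coord M) \<odot> coord N"
    if "well_formed N" "well_formed M" for M N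
    using that(2)
  proof (induction M)
    case (add p M)
    obtain T \<rho> where p: "p = (T, \<rho>)" by force
    with add have T: "T \<in> E" and \<rho>: "\<rho> \<in> Forms n" and M: "well_formed M" by auto
    have "fstar (T 1 \<odot> \<rho>) \<in> Forms n" "fstar (coord M) \<in> Forms n"
      using T \<rho> M by (simp_all add: Forms_fstar Forms_fmul E_coord(2) coord_Forms)
    from fmul_add_left[OF this coord_Forms[OF that(1)]] show ?case
      using add.IH[OF M] p inner[OF that(1) T \<rho>] by (simp add: fstar_add)
  qed simp
  show ?thesis
    unfolding tmetric_def
    using outer[OF trep_tens_of(1)[OF assms(2)] trep_tens_of(1)[OF assms(1)]] trep_tens_of(2) assms by simp
qed


section \<open>Gauge quantum linear connections\<close>

text \<open>
  On a coinvariant form only the component at \<open>z\<^sup>0\<close> of the coaction is present, and there the connection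
  is evaluated at \<open>\<pi>(\<one>) = 0\<close>.  So the correction to the differential vanishes, whatever the connection.
\<close>

lemma dual_cov_deriv_base:
  assumes \<omega>: "\<omega> \<in> qpc" and \<phi>: "\<phi> \<in> Forms n"
  shows "dual_cov_deriv \<omega> \<phi> = fd \<phi>"
proof -
  have lin: "Vector_Spaces.linear (*) fscale \<omega>" using \<omega> by (simp add: qpc_def)
  have \<omega>0: "\<omega> 0 = 0" by (subst linear_eq_frame[OF lin]) (simp add: frame_def fscale_def fun_eq_iff fun_apply_simps)
  have "antipode (antipode g) = g" for g by (simp add: antipode_def)
  then have "inj antipode" by (metis injI)
  moreover have "antipode (zpow 0) = zpow 0" by (auto simp: antipode_def zpow_def fun_eq_iff fun_apply_simps)
  ultimately have "inv antipode (zpow 0) = zpow 0" by (metis inv_f_f)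
  moreover have "qgerm (zpow 0) = 0" by (auto simp: qgerm_def zpow_def intro!: sum.neutral)
  ultimately have "\<omega> (qgerm (inv antipode (zpow j))) \<odot> coaction \<phi> j 0 = 0" for j
    by (cases "j = 0") (simp_all add: coaction_base[OF \<phi>] \<omega>0)
  then show ?thesis by (simp add: dual_cov_deriv_def fun_eq_iff fun_apply_simps)
qed

text \<open>
  In the coordinate of the free module \<open>E\<close> every gauge connection is the differential itself.
\<close>

lemma gauge_qlc_eq:
  assumes "\<omega> \<in> qpc" "T \<in> E" shows "gauge_qlc \<omega> T = tens_of (fd (T 1))"
proof -
  note T = E_coord[OF assms(2)]
  have "dual_cov_deriv \<omega> (T \<theta>) = frame (fd (T 1)) \<theta>" for \<theta>
    by (subst T(3)) (simp add: frame_def dual_cov_deriv_base[OF assms(1) Forms_fscale[OF T(2)]] fd_fscale[OF T(2)])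
  then have "(\<lambda>\<theta>. dual_cov_deriv \<omega> (T \<theta>)) = frame (fd (T 1))" by blast
  then show ?thesis
    using assms(2) T by (simp add: gauge_qlc_def Upsilon_frame Forms_fd)
qed

text \<open>
  The three defining properties are additivity, homogeneity and the Leibniz rule of the differential.
\<close>

lemma gauge_qlc_in_qlc:
  assumes \<omega>: "\<omega> \<in> qpc" shows "gauge_qlc \<omega> \<in> qlc"
  unfolding qlc_def
proof (intro CollectI conjI ballI allI)
  note D = gauge_qlc_eq[OF \<omega>]
  show "gauge_qlc \<omega> \<in> E \<rightarrow>\<^sub>E Tens_deg 1"
  proof (rule PiE_I)
    fix T assume T: "T \<in> E"
    then obtain a where "a \<in> qtorus n" "T 1 = deg0 a" by (rule E_coord_deg0)
    then have "fd (T 1) \<in> Forms_deg n 1" using fd_deg0_degree[of a n] by simp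
    then show "gauge_qlc \<omega> T \<in> Tens_deg 1"
      unfolding D[OF T] tens_of_def pure_def Tens_deg_def using E_unit
      by (intro CollectI exI[of _ "{#(frame fone, fd (T 1))#}"]) auto
  qed (simp add: gauge_qlc_def)
  fix T assume T: "T \<in> E"
  note T1 = E_coord(2)[OF T]
  show "gauge_qlc \<omega> (T + T') = gauge_qlc \<omega> T \<boxplus> gauge_qlc \<omega> T'" if "T' \<in> E" for T'
    using T T1 that E_coord(2)[OF that]
    by (simp add: D E_add tadd_tens_of Forms_fd fd_add[where m = n] plus_fun_apply[of T T'])
  show "gauge_qlc \<omega> (\<lambda>\<theta>. fscale c (T \<theta>)) = tscale c (gauge_qlc \<omega> T)" for c
    using T T1 by (simp add: D E_fscale tscale_tens_of Forms_fd fd_fscale[where m = n])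
  fix b assume b: "b \<in> B"
  obtain a where a: "a \<in> qtorus n" "T 1 = deg0 a" using T by (rule E_coord_deg0)
  have b': "b \<in> Forms n" using b by (simp add: Forms_deg_def)
  have "gauge_qlc \<omega> (rmul T b) = tens_of (fd (T 1 \<odot> b))"
    using T b by (simp add: D E_rmul) (simp add: rmul_def)
  also have "fd (T 1 \<odot> b) = fd (T 1) \<odot> b + T 1 \<odot> fd b"
    unfolding a(2) by (rule fd_deg0_fmul[OF a(1) b']) simp
  also have "tens_of \<dots> = tmul (gauge_qlc \<omega> T) b \<boxplus> pure T (fd b)"
    using T T1 b' by (simp add: D tmul_tens_of pure_eq_tens_of tadd_tens_of Forms_fd Forms_fmul)
  finally show "gauge_qlc \<omega> (rmul T b) = tmul (gauge_qlc \<omega> T) b \<boxplus> pure T (fd b)" .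
qed

text \<open>
  Compatibility with the metric is the Leibniz rule for \<open>T\<^sub>1\<^sup>* T\<^sub>2\<close> combined with \<open>d(a\<^sup>*) = -(da)\<^sup>*\<close>.
\<close>

lemma gauge_qlc_compatible:
  assumes \<omega>: "\<omega> \<in> qpc" shows "gauge_qlc \<omega> \<in> qlc_C"
  unfolding qlc_C_def
proof (intro CollectI conjI ballI gauge_qlc_in_qlc[OF \<omega>])
  fix T1 T2 assume T: "T1 \<in> E" "T2 \<in> E"
  note F = E_coord(2)[OF T(1)] E_coord(2)[OF T(2)]
  obtain a where a: "a \<in> qtorus n" "T1 1 = deg0 a" using T(1) by (rule E_coord_deg0)
  have "fd (metric T1 T2) = fd (fstar (T1 1)) \<odot> T2 1 + fstar (T1 1) \<odot> fd (T2 1)"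
    unfolding metric_def a(2) fstar_deg0 by (rule fd_deg0_fmul) (use a F in auto)
  also have "fd (fstar (T1 1)) = - fstar (fd (T1 1))"
    unfolding a(2) by (rule fd_fstar_deg0[OF a(1)]) simp
  also have "- fstar (fd (T1 1)) \<odot> T2 1 = - (fstar (fd (T1 1)) \<odot> T2 1)"
    using fmul_fscale_left[of "- 1" "fstar (fd (T1 1))" "T2 1"] by (simp only: fscale_minus_1)
  finally show "tmetric (pure T1 fone) (gauge_qlc \<omega> T2) - tmetric (gauge_qlc \<omega> T1) (pure T2 fone)
      = fd (metric T1 T2)"
    using T F by (simp add: gauge_qlc_eq[OF \<omega>] pure_eq_tens_of fmul_fone[of _ n] tmetric_tens_of Forms_fd)
qed

text \<open>
  The defining expression \<open>d(T(\<vartheta>)) \<nu> + T(\<vartheta>) d\<nu>\<close> is \<open>d(T(\<vartheta>) \<nu>)\<close> by the Leibniz rule.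
\<close>

lemma ext_d_gauge_qlc:
  assumes \<omega>: "\<omega> \<in> qpc" and \<mu>: "\<mu> \<in> Forms n"
  shows "ext_d (gauge_qlc \<omega>) (tens_of \<mu>) = tens_of (fd \<mu>)"
  unfolding ext_d_def
proof (rule tlift_tens_of[OF \<mu>])
  fix T \<nu> assume T: "T \<in> E" and \<nu>: "\<nu> \<in> Forms n"
  obtain a where a: "a \<in> qtorus n" "T 1 = deg0 a" using T by (rule E_coord_deg0)
  have "tmul (gauge_qlc \<omega> T) \<nu> \<boxplus> pure T (fd \<nu>) = tens_of (fd (T 1) \<odot> \<nu> + T 1 \<odot> fd \<nu>)"
    using T E_coord(2)[OF T] \<nu>
    by (simp add: gauge_qlc_eq[OF \<omega>] tmul_tens_of pure_eq_tens_of tadd_tens_of Forms_fd Forms_fmul)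
  also have "fd (T 1) \<odot> \<nu> + T 1 \<odot> fd \<nu> = fd (T 1 \<odot> \<nu>)"
    unfolding a(2) by (rule fd_deg0_fmul[OF a(1) \<nu>, symmetric]) simp
  finally show "(case (T, \<nu>) of (T, \<nu>) \<Rightarrow> tmul (gauge_qlc \<omega> T) \<nu> \<boxplus> pure T (fd \<nu>)) = tens_of (fd (T 1 \<odot> \<nu>))"
    by simp
qed (auto intro: Forms_fd fd_add[where m = n])

lemma curvature_gauge_qlc:
  assumes \<omega>: "\<omega> \<in> qpc" and T: "T \<in> E"
  shows "curvature (gauge_qlc \<omega>) T = tens_of 0"
proof -
  obtain a where a: "a \<in> qtorus n" "T 1 = deg0 a" using T by (rule E_coord_deg0)
  have "curvature (gauge_qlc \<omega>) T = tens_of (fd (fd (T 1)))"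
    using T E_coord(2)[OF T] by (simp add: curvature_def gauge_qlc_eq[OF \<omega>] ext_d_gauge_qlc[OF \<omega>] Forms_fd)
  then show ?thesis using a by (simp add: fd_fd_deg0[where m = n])
qed

lemma op_ext_zero:
  assumes "\<And>T. T \<in> E \<Longrightarrow> \<Lambda> T = tens_of 0" "\<mu> \<in> Forms n"
  shows "op_ext \<Lambda> (tens_of \<mu>) = tens_of 0"
  unfolding op_ext_def by (rule tlift_tens_of[OF assms(2)]) (auto simp: assms(1) tmul_tens_of)

text \<open>
  With zero curvature both terms of the commutator are images of \<open>0\<close> under additive extensions.
\<close>

lemma gauge_qlc_Yang_Mills:
  assumes \<omega>: "\<omega> \<in> qpc" shows "gauge_qlc \<omega> \<in> YM_qlc"
  unfolding YM_qlc_def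
proof (intro CollectI conjI ballI gauge_qlc_compatible[OF \<omega>])
  fix T assume T: "T \<in> E"
  let ?\<Lambda> = "id_hodge \<circ> curvature (gauge_qlc \<omega>)"
  have "hodge 0 = 0" by (auto simp: hodge_def fun_eq_iff fun_apply_simps)
  then have \<Lambda>: "?\<Lambda> T = tens_of 0" if "T \<in> E" for T
    by (simp add: curvature_gauge_qlc[OF \<omega> that] id_hodge_tens_of)
  have "op_ext ?\<Lambda> (gauge_qlc \<omega> T) = tens_of 0"
    unfolding gauge_qlc_eq[OF \<omega> T] using E_coord(2)[OF T] by (intro op_ext_zero \<Lambda> Forms_fd) auto
  moreover have "ext_d (gauge_qlc \<omega>) (?\<Lambda> T) = tens_of 0"
    by (simp only: \<Lambda>[OF T] ext_d_gauge_qlc[OF \<omega>] Forms_0 fd_0)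
  moreover have "tscale c (tens_of 0) = tens_of 0" for c
    by (simp add: tscale_tens_of)
  ultimately show "commutator (n - 2) (gauge_qlc \<omega>) ?\<Lambda> T = tzero"
    by (simp only: commutator_def tadd_tens_of[OF Forms_0 Forms_0] add_0_left tzero_eq_tens_of)
qed

end

theorem theorem6p4:
  fixes n :: nat and \<Xi> :: "nat \<Rightarrow> nat \<Rightarrow> real" and \<omega> :: "complex \<Rightarrow> qform"
  assumes "n \<ge> 2"
    and "\<forall>i\<le>n. \<forall>j\<le>n. \<Xi> i j = - \<Xi> j i"
    and "\<omega> \<in> quantum_torus_bundle.qpc n \<Xi>"
  shows "quantum_torus_bundle.gauge_qlc n \<Xi> \<omega> \<in> quantum_torus_bundle.YM_qlc n \<Xi>"
  using assms(3) by (rule quantum_torus_bundle.gauge_qlc_Yang_Mills)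

end
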